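(* Let $\boldsymbol{\mu}_{\mathbf{r}}=(\mu_x,\mu_y,\mu_z)\in\mathbb{R}^3$ with $\mu_x\neq 0$, and let $(\mu_\theta,\mu_\phi)$ be the associated perfect-tracking angles defined in the context. For $\boldsymbol{\sigma}=(\sigma_x,\sigma_y,\sigma_z,\sigma_\theta,\sigma_\phi)\in(0,\infty)^5$ let $\epsilon_s\sim\mathcal{N}(0,\sigma_s^2)$, $s\in\{x,y,z,\theta,\phi\}$, be independent, set $r_x=\mu_x+\epsilon_x$, $r_y=\mu_y+\epsilon_y$, $r_z=\mu_z+\epsilon_z$, $\theta=\mu_\theta+\epsilon_\theta$, $\phi=\mu_\phi+\epsilon_\phi$, and let $$f_y=r_y-r_x\tan(\theta),\qquad f_z=r_z-r_x\frac{\cot(\phi)}{\cos(\theta)},\qquad u=\sqrt{f_y^2+f_z^2}.$$ Let $$\boldsymbol{\Sigma}=\begin{bmatrix}\sigma_y^2+c_1^2\sigma_x^2+c_2^2\sigma_\theta^2 & c_1c_5\sigma_x^2+c_2c_4\sigma_\theta^2\\ c_1c_5\sigma_x^2+c_2c_4\sigma_\theta^2 & \sigma_z^2+c_3^2\sigma_\phi^2+c_4^2\sigma_\theta^2+c_5^2\sigma_x^2\end{bmatrix},$$ where $c_1=-\tan(\mu_\theta)$, $c_2=-\frac{\mu_x}{\cos^2(\mu_\theta)}$, $c_3=\frac{\mu_x}{\sin^2(\mu_\phi)\cos(\mu_\theta)}$, $c_4=-\frac{\mu_x\cot(\mu_\phi)\tan(\mu_\theta)}{\cos(\mu_\theta)}$,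 $c_5=-\frac{\cot(\mu_\phi)}{\cos(\mu_\theta)}$. Let $\lambda_1,\lambda_2$ be the eigenvalues of $\boldsymbol{\Sigma}$ and put $$q=\sqrt{\frac{\min\{\lambda_1,\lambda_2\}}{\max\{\lambda_1,\lambda_2\}}},\qquad \Omega=\lambda_1+\lambda_2.$$ Then, as $\sigma_s\to0$ for all $s\in\{x,y,z,\theta,\phi\}$, $u$ asymptotically follows the Hoyt (Nakagami-$q$) distribution $\mathcal{H}(q,\Omega)$, in the sense that $$\sup_{t\in\mathbb{R}}\big|\Pr(u\le t)-F_{\mathcal{H}(q,\Omega)}(t)\big|\longrightarrow 0\quad\text{as }\boldsymbol{\sigma}\to\mathbf{0}\text{ in }(0,\infty)^5,$$ where $F_{\mathcal{H}(q,\Omega)}$ is the cumulative distribution function of $\mathcal{H}(q,\Omega)$ (and $q,\Omega$ depend on $\boldsymbol{\sigma}$).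
   Context: Perfect tracking: the mean beam direction $(\sin\mu_\phi\cos\mu_\theta,\sin\mu_\phi\sin\mu_\theta,\cos\mu_\phi)$ points from $\boldsymbol{\mu}_{\mathbf{r}}$ to the origin, i.e. $\mu_\theta=\pi+\tan^{-1}(\mu_y/\mu_x)$ if $\mu_x>0$, $\mu_\theta=\tan^{-1}(\mu_y/\mu_x)$ if $\mu_x<0$, and $\mu_\phi=\pi-\cos^{-1}\!\Big(\frac{\mu_z}{\sqrt{\mu_x^2+\mu_y^2+\mu_z^2}}\Big)$. The random variables $f_y,f_z$ (the footprint centre of the beam on the plane $x=0$) are defined almost surely. The Hoyt (Nakagami-$q$) distribution $\mathcal{H}(q,\Omega)$ with $q\in(0,1]$, $\Omega>0$ has density on $[0,\infty)$ $$f(t)=\frac{(1+q^2)\,t}{q\,\Omega}\exp\Big(-\frac{(1+q^2)^2t^2}{4q^2\Omega}\Big)I_0\Big(\frac{(1-q^4)t^2}{4q^2\Omega}\Big),$$ where $I_0$ is the zero-order modified Bessel function of the first kind; equivalently, it is the law of $\sqrt{g_1^2+g_2^2}$ for independent zero-mean Gaussians $g_1,g_2$ with variances $\frac{\Omega}{1+q^2}$ and $\frac{q^2\Omega}{1+q^2}$. *)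

theory Defs
  imports "HOL-Probability.Probability" "Jordan_Normal_Form.Char_Poly"
begin

text \<open>Both libraries use the same infix for vector access; here it is the one of \<open>real ^ 'n\<close>.\<close>

no_notation Matrix.vec_index (infixl "$" 100)

text \<open>The five independent sources of randomness: the three position coordinates and the
  azimuth and polar angle of the beam.\<close>

datatype source = SX | SY | SZ | STheta | SPhi

lemma UNIV_source: "UNIV = {SX, SY, SZ, STheta, SPhi}"
proof -
  have "s \<in> {SX, SY, SZ, STheta, SPhi}" for s
    by (cases s) auto
  then show ?thesis by blast
qed

instance source :: finite
  by standard (simp add: UNIV_source)

text \<open>Angles of the beam that points from \<open>(mx, my, mz)\<close> to the origin, for \<open>mx \<noteq> 0\<close>;
  see \<open>perfect_tracking\<close> below.\<close>

definition track_theta :: "real \<Rightarrow> real \<Rightarrow> real" where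
  "track_theta mx my = (if mx > 0 then pi + arctan (my / mx) else arctan (my / mx))"

definition track_phi :: "real \<Rightarrow> real \<Rightarrow> real \<Rightarrow> real" where
  "track_phi mx my mz = pi - arccos (mz / sqrt (mx\<^sup>2 + my\<^sup>2 + mz\<^sup>2))"

lemma perfect_tracking:
  fixes mx my mz :: real
  assumes "mx \<noteq> 0"
  defines "R \<equiv> sqrt (mx\<^sup>2 + my\<^sup>2 + mz\<^sup>2)"
    and "th \<equiv> track_theta mx my" and "ph \<equiv> track_phi mx my mz"
  shows "sin ph * cos th = - mx / R" "sin ph * sin th = - my / R" "cos ph = - mz / R"
proof -
  have mx2: "mx\<^sup>2 > 0" using assms(1) by simp
  have Rpos: "R > 0" unfolding R_def using mx2
    by (simp add: add_pos_nonneg)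
  have R2: "R\<^sup>2 = mx\<^sup>2 + my\<^sup>2 + mz\<^sup>2" unfolding R_def by simp
  have "\<bar>mz\<bar> \<le> R" unfolding R_def by (rule real_le_rsqrt) simp
  then have bd: "\<bar>mz / R\<bar> \<le> 1" using Rpos by simp
  show "cos ph = - mz / R"
    using bd by (simp add: ph_def track_phi_def R_def [symmetric] cos_arccos_abs cos_diff)
  define D where "D = sqrt (mx\<^sup>2 + my\<^sup>2)"
  have Dpos: "D > 0" unfolding D_def using mx2 by (simp add: add_pos_nonneg)
  have D2: "D\<^sup>2 = mx\<^sup>2 + my\<^sup>2" unfolding D_def by simp
  have "1 - (mz / R)\<^sup>2 = (D / R)\<^sup>2"
  proof -
    have "R\<^sup>2 - mz\<^sup>2 = D\<^sup>2" using R2 D2 by simp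
    then have "(R\<^sup>2 - mz\<^sup>2) / R\<^sup>2 = D\<^sup>2 / R\<^sup>2" by simp
    then show ?thesis using Rpos by (simp add: diff_divide_distrib power_divide)
  qed
  then have sph: "sin ph = D / R"
    using bd Rpos Dpos
    by (simp add: ph_def track_phi_def R_def [symmetric] sin_diff sin_arccos_abs)
  have "1 + (my / mx)\<^sup>2 = (D / \<bar>mx\<bar>)\<^sup>2"
    using assms(1) by (simp add: D2 power_divide add_divide_distrib)
  then have sq: "sqrt (1 + (my / mx)\<^sup>2) = D / \<bar>mx\<bar>"
    using Dpos by simp
  have cth: "cos th = - mx / D"
    using assms(1) Dpos
    by (auto simp: th_def track_theta_def cos_add cos_arctan sq)
  have sth: "sin th = - my / D"
    using assms(1) Dpos
    by (auto simp: th_def track_theta_def sin_add sin_arctan sq)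
  show "sin ph * cos th = - mx / R" "sin ph * sin th = - my / R"
    using Dpos by (simp_all add: sph cth sth)
qed

text \<open>Centre of the beam footprint on the plane \<open>x = 0\<close>. On the null event where the tangent,
  the cotangent or the quotient is undefined, HOL assigns junk values; this does not affect any
  probability.\<close>

definition footprint_y :: "real \<Rightarrow> real \<Rightarrow> real \<Rightarrow> real" where
  "footprint_y rx ry th = ry - rx * tan th"

definition footprint_z :: "real \<Rightarrow> real \<Rightarrow> real \<Rightarrow> real \<Rightarrow> real" where
  "footprint_z rx rz th ph = rz - rx * (cot ph / cos th)"

text \<open>The argument \<open>e\<close> collects the realisations of the five Gaussian errors.\<close>

definition pointing_error :: "real \<Rightarrow> real \<Rightarrow> real \<Rightarrow> (source \<Rightarrow> real) \<Rightarrow> real" where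
  "pointing_error mx my mz e =
    (let rx = mx + e SX; ry = my + e SY; rz = mz + e SZ;
         th = track_theta mx my + e STheta;
         ph = track_phi mx my mz + e SPhi
     in sqrt ((footprint_y rx ry th)\<^sup>2 + (footprint_z rx rz th ph)\<^sup>2))"

text \<open>The matrix is real symmetric of size two, so an equation
  \<open>{k. eigenvalue (Sigma_matrix mx my mz \<sigma>) k} = {a, b}\<close> says that \<open>a\<close> and \<open>b\<close> are its eigenvalues
  counted with multiplicity.\<close>

definition Sigma_matrix :: "real \<Rightarrow> real \<Rightarrow> real \<Rightarrow> real ^ source \<Rightarrow> real mat" where
  "Sigma_matrix mx my mz \<sigma> =
    (let th = track_theta mx my; ph = track_phi mx my mz;
         c1 = - tan th;
         c2 = - (mx / (cos th)\<^sup>2);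
         c3 = mx / ((sin ph)\<^sup>2 * cos th);
         c4 = - (mx * cot ph * tan th / cos th);
         c5 = - (cot ph / cos th);
         a = (\<sigma> $ SY)\<^sup>2 + c1\<^sup>2 * (\<sigma> $ SX)\<^sup>2 + c2\<^sup>2 * (\<sigma> $ STheta)\<^sup>2;
         b = c1 * c5 * (\<sigma> $ SX)\<^sup>2 + c2 * c4 * (\<sigma> $ STheta)\<^sup>2;
         d = (\<sigma> $ SZ)\<^sup>2 + c3\<^sup>2 * (\<sigma> $ SPhi)\<^sup>2 + c4\<^sup>2 * (\<sigma> $ STheta)\<^sup>2 + c5\<^sup>2 * (\<sigma> $ SX)\<^sup>2
     in mat_of_rows_list 2 [[a, b], [b, d]])"

text \<open>Modified Bessel function of the first kind of order zero.\<close>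

definition bessel_I0 :: "real \<Rightarrow> real" where
  "bessel_I0 x = (\<Sum>k. (x / 2) ^ (2 * k) / (fact k)\<^sup>2)"

definition hoyt_density :: "real \<Rightarrow> real \<Rightarrow> real \<Rightarrow> real" where
  "hoyt_density q \<Omega> t =
    (if t < 0 then 0
     else (1 + q\<^sup>2) * t / (q * \<Omega>) * exp (- ((1 + q\<^sup>2)\<^sup>2 * t\<^sup>2 / (4 * q\<^sup>2 * \<Omega>)))
            * bessel_I0 ((1 - q ^ 4) * t\<^sup>2 / (4 * q\<^sup>2 * \<Omega>)))"

definition hoyt :: "real \<Rightarrow> real \<Rightarrow> real measure" where
  "hoyt q \<Omega> = density lborel (\<lambda>t. ennreal (hoyt_density q \<Omega> t))"

end

theory Submission
  imports Defs
begin

text \<open>Near the mean, the footprint centre is the linear Gaussian vector \<open>G\<close> with covariance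
  \<open>\<Sigma>\<close> up to an error \<open>o(\<bar>\<epsilon>\<^sub>\<theta>\<bar> + \<bar>\<epsilon>\<^sub>\<phi>\<bar>)\<close>; the error in \<open>r\<^sub>x\<close> enters only through its product with
  the angular errors. Since \<open>\<Omega> = tr \<Sigma>\<close> dominates multiples of \<open>\<sigma>\<^sub>\<theta>\<^sup>2\<close> and \<open>\<sigma>\<^sub>\<phi>\<^sup>2\<close>, Chebyshev's
  inequality makes the error \<open>o(\<surd>\<Omega>)\<close> in probability, however degenerate \<open>\<Sigma>\<close> becomes. In polar
  coordinates \<open>norm G\<close> has exactly the Hoyt density, and this density is at most \<open>2 / \<surd>\<Omega>\<close>
  uniformly in \<open>q\<close>, so a perturbation of size \<open>o(\<surd>\<Omega>)\<close> changes the distribution function by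
  \<open>o(1)\<close>, uniformly in \<open>t\<close>.\<close>

section \<open>The Bessel function as an angular integral\<close>

text \<open>Since \<open>\<sigma>\<close> tends to 0 along an arbitrary path, the covariance matrix
  divided by its trace need not converge and \<open>q\<close> may tend to 0, so there is no limit
  law for a delta-method argument, and the spaces \<open>M \<sigma>\<close> are unrelated to each
  other. Hence every estimate is an explicit inequality for one fixed \<open>\<sigma>\<close>, with
  constants that depend only on the mean position and the target accuracy. Two points are delicate.
  The remainder must not contain a term in \<open>\<epsilon>\<^sub>x\<close> alone: for
  \<open>my = mz = 0\<close> the trace does not involve \<open>\<sigma>\<^sub>x\<close> and could
  not absorb it. And the density bound cannot come from
  \<open>bessel_I0 y \<le> exp \<bar>y\<bar>\<close>, which only gives the order of one over the
  root of the smaller eigenvalue; a Gaussian majorant of the angular integral is used instead. The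
  covariance matrix is never diagonalised: its eigenvalues enter through trace and determinant, and
  the direction of its axes becomes a phase, to which an integral over a full period is
  indifferent.\<close>

lemma has_integral_cos_power:
  fixes \<psi> :: real
  shows "((\<lambda>x. cos (2 * x + \<psi>) ^ n) has_integral
           (if even n then pi * real (n choose (n div 2)) / 2 ^ n else 0)) {-(pi/2)..pi/2}"
proof (induction n rule: nat_induct2)
  case 0
  show ?case using has_integral_const_real[of "1::real" "-(pi/2)" "pi/2"] by simp
next
  case 1
  have "((\<lambda>x. cos (2 * x + \<psi>)) has_integral
      sin (2 * (pi/2) + \<psi>) / 2 - sin (2 * (-(pi/2)) + \<psi>) / 2) {-(pi/2)..pi/2}"
    by (intro fundamental_theorem_of_calculus)
       (auto intro!: derivative_eq_intros simp flip: has_real_derivative_iff_has_vector_derivative)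
  then show ?case by (simp add: sin_add)
next
  case (step n)
  define W where "W = (if even n then pi * real (n choose (n div 2)) / 2 ^ n else 0)"
  \<comment> \<open>Wallis reduction: the derivative of \<open>G\<close> is the integrand of order
    \<open>n + 2\<close> minus \<open>(n + 1) / (n + 2)\<close> times that of order
    \<open>n\<close>. As \<open>G\<close> has period \<open>pi\<close>, the boundary terms cancel
    for every phase.\<close>
  define G where "G x = sin (2 * x + \<psi>) * cos (2 * x + \<psi>) ^ Suc n / (2 * real (n + 2))" for x
  have "((\<lambda>x. cos (2 * x + \<psi>) ^ (n + 2) - real (n + 1) / real (n + 2) * cos (2 * x + \<psi>) ^ n)
      has_integral G (pi/2) - G (-(pi/2))) {-(pi/2)..pi/2}"
  proof (intro fundamental_theorem_of_calculus)
    fix x :: real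
    define c s where "c = cos (2 * x + \<psi>)" and "s = sin (2 * x + \<psi>)"
    have s2: "s * s = 1 - c * c"
      using sin_cos_squared_add[of "2 * x + \<psi>"] by (simp add: c_def s_def power2_eq_square)
    have d: "((\<lambda>x. sin (2 * x + \<psi>)) has_real_derivative 2 * c) (at x)"
      "((\<lambda>x. cos (2 * x + \<psi>)) has_real_derivative - (2 * s)) (at x)"
      unfolding c_def s_def by (auto intro!: derivative_eq_intros)
    have "(G has_real_derivative (2 * c * c ^ Suc n + (1 + real n) * (- (2 * s) * c ^ n) * s) / (2 * real (n + 2))) (at x)"
      unfolding G_def using DERIV_cdivide[OF DERIV_mult[OF d(1) DERIV_power_Suc[OF d(2), of n]]]
      by (simp add: c_def s_def)
    also have "(2 * c * c ^ Suc n + (1 + real n) * (- (2 * s) * c ^ n) * s) / (2 * real (n + 2))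
       = (2 * c * c ^ Suc n - 2 * (s * s) * (real (Suc n) * c ^ n)) / (2 * real (n + 2))"
      by (rule arg_cong[where f = "\<lambda>z. z / (2 * real (n + 2))"]) (simp add: algebra_simps)
    also have "\<dots> = c ^ (n + 2) - real (n + 1) / real (n + 2) * c ^ n"
      unfolding s2 by (simp add: field_simps)
    finally show "(G has_vector_derivative cos (2 * x + \<psi>) ^ (n + 2)
        - real (n + 1) / real (n + 2) * cos (2 * x + \<psi>) ^ n) (at x within {-(pi/2)..pi/2})"
      unfolding c_def s_def
      by (metis has_real_derivative_iff_has_vector_derivative has_vector_derivative_at_within)
  qed simp
  moreover have "G (pi/2) - G (-(pi/2)) = 0"
    by (simp add: G_def sin_add cos_add)
  ultimately have "((\<lambda>x. (cos (2 * x + \<psi>) ^ (n + 2) - real (n + 1) / real (n + 2) * cos (2 * x + \<psi>) ^ n)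
      + real (n + 1) / real (n + 2) * cos (2 * x + \<psi>) ^ n)
      has_integral 0 + real (n + 1) / real (n + 2) * W) {-(pi/2)..pi/2}"
    using step unfolding W_def by (intro has_integral_add has_integral_mult_right) auto
  \<comment> \<open>The Wallis factor is a quarter of the ratio of consecutive central binomial
    coefficients.\<close>
  moreover have "real (n + 1) / real (n + 2) * W =
     (if even (n + 2) then pi * real ((n + 2) choose ((n + 2) div 2)) / 2 ^ (n + 2) else 0)"
  proof (cases "even n")
    case True
    then obtain k where k: "n = 2 * k" by blast
    have f: "real ((2 * k + 2) choose (k + 1)) = fact (2 * k + 2) / (fact (k + 1) * fact (k + 1))"
      "real ((2 * k) choose k) = fact (2 * k) / (fact k * fact k)"
      using binomial_fact[of "k + 1" "2 * k + 2", where ?'a = real] binomial_fact[of k "2 * k", where ?'a = real]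
      by simp_all
    have "real (2 * k + 1) / real (2 * k + 2) * (pi * (fact (2 * k) / (fact k * fact k)) / 2 ^ (2 * k))
      = pi * (fact (2 * k + 2) / (fact (k + 1) * fact (k + 1))) / 2 ^ (2 * k + 2)"
      by (simp add: divide_simps) (simp add: algebra_simps)
    then have "real (2 * k + 1) / real (2 * k + 2) * (pi * real ((2 * k) choose k) / 2 ^ (2 * k))
      = pi * real ((2 * k + 2) choose (k + 1)) / 2 ^ (2 * k + 2)"
      unfolding f .
    moreover have "(2 * k + 2) div 2 = k + 1" by simp
    ultimately show ?thesis by (simp only: W_def k) simp
  qed (simp add: W_def)
  ultimately show ?case by simp
qed

lemma summable_bessel_I0: "summable (\<lambda>k. (x / 2) ^ (2 * k) / (fact k)\<^sup>2 :: real)"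
proof (rule summable_comparison_test)
  show "summable (\<lambda>k. inverse (fact k) * ((x / 2)\<^sup>2) ^ k)" by (rule summable_exp)
  have "(1::real) / (fact k)\<^sup>2 \<le> inverse (fact k)" for k
    by (simp add: divide_simps power2_eq_square)
  then have "((x / 2)\<^sup>2) ^ k * (1 / (fact k)\<^sup>2) \<le> ((x / 2)\<^sup>2) ^ k * inverse (fact k)" for k
    by (intro mult_left_mono) auto
  then show "\<exists>N. \<forall>k\<ge>N. norm ((x / 2) ^ (2 * k) / (fact k)\<^sup>2) \<le> inverse (fact k) * ((x / 2)\<^sup>2) ^ k"
    unfolding power_mult by (simp add: mult.commute del: power_divide)
qed

lemma bessel_I0_sums: "(\<lambda>k. (x / 2) ^ (2 * k) / (fact k)\<^sup>2) sums bessel_I0 x"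
  unfolding bessel_I0_def using summable_bessel_I0 by (rule summable_sums)

lemma bessel_I0_ge_1: "1 \<le> bessel_I0 x"
proof -
  have "(\<Sum>k<1. (x / 2) ^ (2 * k) / (fact k)\<^sup>2) \<le> bessel_I0 x"
    unfolding bessel_I0_def by (rule sum_le_suminf[OF summable_bessel_I0]) auto
  then show ?thesis by simp
qed

lemma borel_measurable_bessel_I0 [measurable]: "bessel_I0 \<in> borel_measurable borel"
  unfolding bessel_I0_def[abs_def] by measurable

text \<open>Every phase \<open>\<psi>\<close> gives the same value since the moments of \<open>cos\<close> over a full period do not
  depend on it.\<close>

lemma has_integral_exp_cos:
  "((\<lambda>x. exp (y * cos (2 * x + \<psi>))) has_integral pi * bessel_I0 y) {-(pi/2)..pi/2}"
proof -
  define f where "f n x = (\<Sum>k<n. y ^ k / fact k * cos (2 * x + \<psi>) ^ k)" for n x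
  define J where "J k = y ^ k / fact k * (if even k then pi * real (k choose (k div 2)) / 2 ^ k else 0)" for k
  have u: "uniform_limit {-(pi/2)..pi/2} f (\<lambda>x. \<Sum>k. y ^ k / fact k * cos (2 * x + \<psi>) ^ k) sequentially"
    unfolding f_def
  proof (rule Weierstrass_m_test)
    show "summable (\<lambda>k. inverse (fact k) * \<bar>y\<bar> ^ k)" by (rule summable_exp)
    show "norm (y ^ k / fact k * cos (2 * x + \<psi>) ^ k) \<le> inverse (fact k) * \<bar>y\<bar> ^ k" for k x
    proof -
      have "\<bar>y\<bar> ^ k * \<bar>cos (2 * x + \<psi>)\<bar> ^ k \<le> \<bar>y\<bar> ^ k * 1"
        by (intro mult_left_mono power_le_one) auto
      then show ?thesis by (simp add: abs_mult power_abs field_simps)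
    qed
  qed
  obtain I K where I: "\<And>n. (f n has_integral I n) {-(pi/2)..pi/2}"
    and K: "((\<lambda>x. \<Sum>k. y ^ k / fact k * cos (2 * x + \<psi>) ^ k) has_integral K) {-(pi/2)..pi/2}"
    and lim: "I \<longlonglongrightarrow> K"
    by (rule uniform_limit_integral[OF u])
       (auto simp: f_def intro!: continuous_intros)
  have "(f n has_integral (\<Sum>k<n. J k)) {-(pi/2)..pi/2}" for n
    unfolding f_def J_def by (intro has_integral_sum has_integral_mult_right has_integral_cos_power) auto
  then have "I = (\<lambda>n. \<Sum>k<n. J k)" using I has_integral_unique by blast
  then have "J sums K" using lim unfolding sums_def by simp
  moreover have "J sums (pi * bessel_I0 y)"
  proof -
    \<comment> \<open>\<open>(2 * k) choose k\<close> over \<open>fact (2 * k)\<close> is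
      \<open>1 / (fact k)\<^sup>2\<close>: the even Taylor terms of \<open>exp\<close> turn into the
      Bessel terms, and the odd ones integrate to 0.\<close>
    have *: "J (2 * k) = pi * ((y / 2) ^ (2 * k) / (fact k)\<^sup>2)" for k
      by (simp add: J_def binomial_fact power_divide power2_eq_square field_simps)
    have "(\<lambda>k. J (2 * k)) sums (pi * bessel_I0 y)"
      unfolding * by (intro sums_mult bessel_I0_sums)
    then show ?thesis
    proof (subst (asm) sums_mono_reindex)
      show "strict_mono (\<lambda>k. 2 * k :: nat)" by (simp add: strict_mono_def)
      show "J n = 0" if "n \<notin> range (\<lambda>k. 2 * k :: nat)" for n
        using that by (auto simp: J_def elim!: evenE)
    qed
  qed
  ultimately have "K = pi * bessel_I0 y" using sums_unique2 by blast
  moreover have "(\<Sum>k. y ^ k / fact k * cos (2 * x + \<psi>) ^ k) = exp (y * cos (2 * x + \<psi>))" for x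
    by (simp add: exp_def power_mult_distrib scaleR_conv_of_real field_simps)
  ultimately show ?thesis using K by simp
qed

text \<open>The slope \<open>m = tan x\<close> serves as angular coordinate in the polar integral
  below, with \<open>dm = (1 + m\<^sup>2) dx\<close>. Nonnegativity of \<open>h\<close> supplies the
  absolute integrability that the change of variables requires.\<close>

lemma nn_integral_tan_substitution:
  fixes h :: "real \<Rightarrow> real"
  assumes h: "\<And>m. 0 \<le> h m" and J: "((\<lambda>x. h (tan x)) has_integral J) {-(pi/2)<..<pi/2}"
  shows "(\<integral>\<^sup>+m. ennreal (h m / (1 + m\<^sup>2)) \<partial>lborel) = ennreal J"
proof -
  let ?S = "{-(pi/2)<..<pi/2}"
  have img: "tan ` ?S = UNIV"
    using arctan_lbound arctan_ubound tan_arctan by (metis (no_types, lifting) UNIV_eq_I greaterThanLessThan_iff image_eqI minus_divide_left)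
  have cosp: "cos x > 0" if "x \<in> ?S" for x using that by (auto intro: cos_gt_zero_pi)
  have eq: "\<bar>inverse ((cos x)\<^sup>2)\<bar> * (h (tan x) / (1 + (tan x)\<^sup>2)) = h (tan x)" if "x \<in> ?S" for x
  proof -
    have "cos x \<noteq> 0" using cosp[OF that] by simp
    then show ?thesis by (subst tan_sec) (simp_all add: divide_simps)
  qed
  have 1: "((\<lambda>x. \<bar>inverse ((cos x)\<^sup>2)\<bar> * (h (tan x) / (1 + (tan x)\<^sup>2))) has_integral J) ?S"
    by (rule has_integral_eq[rotated, OF J]) (simp only: eq)
  have 2: "(\<lambda>x. \<bar>inverse ((cos x)\<^sup>2)\<bar> * (h (tan x) / (1 + (tan x)\<^sup>2))) absolutely_integrable_on ?S"
    using 1 h by (intro nonnegative_absolutely_integrable_1) (auto simp: has_integral_iff)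
  have "(\<lambda>m. h m / (1 + m\<^sup>2)) absolutely_integrable_on (tan ` ?S) \<and>
      integral (tan ` ?S) (\<lambda>m. h m / (1 + m\<^sup>2)) = J"
  proof (rule has_absolute_integral_change_of_variables_1'[THEN iffD1])
    show "(tan has_field_derivative inverse ((cos x)\<^sup>2)) (at x within ?S)" if "x \<in> ?S" for x
      using cosp[OF that] by (intro DERIV_subset[OF DERIV_tan]) auto
    show "inj_on tan ?S"
      by (intro inj_onI) (metis arctan_tan greaterThanLessThan_iff)
  qed (use 1 2 in \<open>auto simp: has_integral_iff\<close>)
  then have "((\<lambda>m. h m / (1 + m\<^sup>2)) has_integral J) UNIV"
    unfolding img by (auto simp: has_integral_iff absolutely_integrable_on_def)
  then have "(\<integral>\<^sup>+x. ennreal (indicator UNIV x * (h x / (1 + x\<^sup>2))) \<partial>lborel) = ennreal J"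
    by (intro nn_integral_has_integral_lebesgue) (use h in auto)
  then show ?thesis by simp
qed

section \<open>Planar Gaussian densities\<close>

text \<open>The centred Gaussian density with covariance matrix \<open>[[a, b], [b, d]]\<close>, the
  inverse matrix being written as adjugate over determinant. Positive definiteness
  (\<open>a > 0\<close> and \<open>a * d - b\<^sup>2 > 0\<close>) is left to the lemmas.\<close>

definition gauss2 :: "real \<Rightarrow> real \<Rightarrow> real \<Rightarrow> real \<times> real \<Rightarrow> real" where
  "gauss2 a b d = (\<lambda>(x, y). exp (- ((d * x\<^sup>2 - 2 * b * x * y + a * y\<^sup>2) / (2 * (a * d - b\<^sup>2))))
     / (2 * pi * sqrt (a * d - b\<^sup>2)))"

lemma borel_measurable_gauss2 [measurable]: "gauss2 a b d \<in> borel_measurable borel"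
  unfolding gauss2_def by (simp add: borel_prod[symmetric])

lemma gauss2_nonneg: "a * d - b\<^sup>2 > 0 \<Longrightarrow> 0 \<le> gauss2 a b d w"
  by (simp add: gauss2_def split_beta)

lemma gauss2_diag:
  assumes "s > 0" "t > 0"
  shows "gauss2 (s\<^sup>2) 0 (t\<^sup>2) (x, y) = normal_density 0 s x * normal_density 0 t y"
proof -
  have 1: "sqrt (s\<^sup>2 * t\<^sup>2) = s * t" using assms by (simp add: real_sqrt_mult)
  have 2: "sqrt (2 * pi * s\<^sup>2) * sqrt (2 * pi * t\<^sup>2) = 2 * pi * (s * t)"
    using assms by (simp add: real_sqrt_mult[symmetric]) (simp add: real_sqrt_mult power2_eq_square)
  have 3: "(t\<^sup>2 * x\<^sup>2 + s\<^sup>2 * y\<^sup>2) / (2 * (s\<^sup>2 * t\<^sup>2)) = x\<^sup>2 / (2 * s\<^sup>2) + y\<^sup>2 / (2 * t\<^sup>2)"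
    using assms by (simp add: field_simps)
  have "gauss2 (s\<^sup>2) 0 (t\<^sup>2) (x, y) = exp (- (x\<^sup>2 / (2 * s\<^sup>2) + y\<^sup>2 / (2 * t\<^sup>2))) / (2 * pi * (s * t))"
    unfolding gauss2_def 3[symmetric] 1[symmetric] by simp
  also have "\<dots> = (exp (- (x\<^sup>2 / (2 * s\<^sup>2))) * exp (- (y\<^sup>2 / (2 * t\<^sup>2)))) / (sqrt (2 * pi * s\<^sup>2) * sqrt (2 * pi * t\<^sup>2))"
    unfolding 2 by (simp add: mult_exp_exp)
  also have "\<dots> = normal_density 0 s x * normal_density 0 t y"
    by (simp add: normal_density_def)
  finally show ?thesis .
qed

text \<open>Adding an independent Gaussian multiple of the vector \<open>(p, r)\<close> is a rank-one update of the
  covariance matrix with entries \<open>a\<close>, \<open>b\<close>, \<open>d\<close>.\<close>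

lemma det_rank_one_update:
  fixes a b d p r s :: real
  shows "(a + p\<^sup>2 * s\<^sup>2) * (d + r\<^sup>2 * s\<^sup>2) - (b + p * r * s\<^sup>2)\<^sup>2
    = (a * d - b\<^sup>2) + s\<^sup>2 * (d * p\<^sup>2 - 2 * b * p * r + a * r\<^sup>2)"
  by (simp add: power2_eq_square algebra_simps)

text \<open>The determinant grows by \<open>s\<^sup>2\<close> times the adjugate form at
  \<open>(p, r)\<close>; multiplying that form by \<open>a > 0\<close> makes it a square plus
  \<open>p\<^sup>2\<close> times the old determinant.\<close>

lemma det_rank_one_update_pos:
  fixes a b d p r s :: real
  assumes "a > 0" "a * d - b\<^sup>2 > 0"
  shows "(a + p\<^sup>2 * s\<^sup>2) * (d + r\<^sup>2 * s\<^sup>2) - (b + p * r * s\<^sup>2)\<^sup>2 > 0"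
proof -
  have "a * (d * p\<^sup>2 - 2 * b * p * r + a * r\<^sup>2) = (a * r - b * p)\<^sup>2 + p\<^sup>2 * (a * d - b\<^sup>2)"
    by (simp add: power2_eq_square algebra_simps)
  also have "\<dots> \<ge> 0" using assms by simp
  finally have "d * p\<^sup>2 - 2 * b * p * r + a * r\<^sup>2 \<ge> 0"
    using assms(1) by (simp add: zero_le_mult_iff)
  then show ?thesis unfolding det_rank_one_update using assms(2) by (simp add: add_pos_nonneg)
qed

text \<open>Bayes' rule for \<open>X + Z (p, r)\<close> with independent \<open>X\<close> and
  \<open>Z\<close>: the joint density of the sum and \<open>Z\<close> is the density of the sum
  times the conditional density of \<open>Z\<close>, whose mean is \<open>\<mu>\<close> and whose
  variance is \<open>\<tau>\<^sup>2\<close>.\<close>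

lemma gauss2_complete_square:
  fixes a b d p r s x y z :: real
  assumes a: "a > 0" and D: "a * d - b\<^sup>2 > 0" and s: "s > 0"
  defines "a' \<equiv> a + p\<^sup>2 * s\<^sup>2" and "b' \<equiv> b + p * r * s\<^sup>2" and "d' \<equiv> d + r\<^sup>2 * s\<^sup>2"
  defines "D' \<equiv> a' * d' - b'\<^sup>2"
  defines "\<mu> \<equiv> (d * p * x - b * (p * y + r * x) + a * r * y) * s\<^sup>2 / D'"
    and "\<tau> \<equiv> sqrt (s\<^sup>2 * (a * d - b\<^sup>2) / D')"
  shows "gauss2 a b d (x - p * z, y - r * z) * normal_density 0 s z
    = gauss2 a' b' d' (x, y) * normal_density \<mu> \<tau> z"
proof -
  define D where "D = a * d - b\<^sup>2"
  define B where "B = d * p * x - b * (p * y + r * x) + a * r * y"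
  define Q where "Q = d * (x - p * z)\<^sup>2 - 2 * b * (x - p * z) * (y - r * z) + a * (y - r * z)\<^sup>2"
  define Q' where "Q' = d' * x\<^sup>2 - 2 * b' * x * y + a' * y\<^sup>2"
  have Dp: "D > 0" using D by (simp add: D_def)
  have D'p: "D' > 0" unfolding D'_def a'_def b'_def d'_def by (rule det_rank_one_update_pos[OF a D])
  have \<tau>2: "\<tau>\<^sup>2 = s\<^sup>2 * D / D'" unfolding \<tau>_def using Dp D'p s by (simp add: D_def)
  have key: "s\<^sup>2 * D' * Q + D * D' * z\<^sup>2 = s\<^sup>2 * D * Q' + (D' * z - B * s\<^sup>2)\<^sup>2"
  proof -
    define K where "K = d * p\<^sup>2 - 2 * b * p * r + a * r\<^sup>2"
    define Q0 where "Q0 = d * x\<^sup>2 - 2 * b * x * y + a * y\<^sup>2"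
    define W where "W = (r * x - p * y)\<^sup>2"
    have D': "D' = D + s\<^sup>2 * K"
      unfolding D'_def a'_def b'_def d'_def det_rank_one_update D_def K_def ..
    have Q: "Q = Q0 - 2 * B * z + K * z\<^sup>2"
      unfolding Q_def Q0_def B_def K_def by (simp add: power2_eq_square algebra_simps)
    have Q': "Q' = Q0 + s\<^sup>2 * W"
      unfolding Q'_def Q0_def W_def a'_def b'_def d'_def by (simp add: power2_eq_square algebra_simps)
    \<comment> \<open>Lagrange's identity for the adjugate form: \<open>K\<close> and
      \<open>Q0\<close> are its values at \<open>(p, r)\<close> and \<open>(x, y)\<close>,
      \<open>B\<close> is its polar form there, and its determinant is again \<open>D\<close>. All
      other terms of \<open>key\<close> cancel.\<close>
    have lagrange: "K * Q0 = D * W + B\<^sup>2"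
      unfolding K_def Q0_def W_def D_def B_def by (simp add: power2_eq_square algebra_simps)
    have "s\<^sup>2 * D' * Q + D * D' * z\<^sup>2 - (s\<^sup>2 * D * Q' + (D' * z - B * s\<^sup>2)\<^sup>2)
      = s\<^sup>2 * s\<^sup>2 * (K * Q0 - (D * W + B\<^sup>2))"
      unfolding D' Q Q' by (simp add: power2_eq_square algebra_simps)
    then show ?thesis unfolding lagrange by simp
  qed
  have "Q / (2 * D) + z\<^sup>2 / (2 * s\<^sup>2) = (s\<^sup>2 * D' * Q + D * D' * z\<^sup>2) / (2 * s\<^sup>2 * D * D')"
    using Dp D'p s by (simp add: field_simps)
  also have "\<dots> = Q' / (2 * D') + (D' * z - B * s\<^sup>2)\<^sup>2 / (2 * s\<^sup>2 * D * D')"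
    unfolding key using Dp D'p s by (simp add: field_simps)
  also have "D' * z - B * s\<^sup>2 = D' * (z - \<mu>)" using D'p by (simp add: \<mu>_def B_def right_diff_distrib)
  also have "(D' * (z - \<mu>))\<^sup>2 / (2 * s\<^sup>2 * D * D') = (z - \<mu>)\<^sup>2 / (2 * \<tau>\<^sup>2)"
    unfolding \<tau>2 using Dp D'p s by (simp add: field_simps power2_eq_square)
  finally have ex: "Q / (2 * D) + z\<^sup>2 / (2 * s\<^sup>2) = Q' / (2 * D') + (z - \<mu>)\<^sup>2 / (2 * \<tau>\<^sup>2)" .
  have sq: "sqrt D * sqrt (2 * pi * s\<^sup>2) = sqrt D' * sqrt (2 * pi * \<tau>\<^sup>2)"
    unfolding \<tau>2 real_sqrt_mult[symmetric] using Dp D'p by (simp add: field_simps)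
  have split: "exp (- u) / (2 * pi * A) * (exp (- v) / B) = exp (- (u + v)) / (2 * pi * (A * B))" for u v A B :: real
    by (simp add: mult_exp_exp)
  have g: "gauss2 a b d (x - p * z, y - r * z) = exp (- (Q / (2 * D))) / (2 * pi * sqrt D)"
    "gauss2 a' b' d' (x, y) = exp (- (Q' / (2 * D'))) / (2 * pi * sqrt D')"
    by (simp_all add: gauss2_def Q_def D_def Q'_def D'_def)
  have n: "normal_density 0 s z = exp (- (z\<^sup>2 / (2 * s\<^sup>2))) / sqrt (2 * pi * s\<^sup>2)"
    "normal_density \<mu> \<tau> z = exp (- ((z - \<mu>)\<^sup>2 / (2 * \<tau>\<^sup>2))) / sqrt (2 * pi * \<tau>\<^sup>2)"
    by (simp_all add: normal_density_def)
  have "gauss2 a b d (x - p * z, y - r * z) * normal_density 0 s z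
     = exp (- (Q / (2 * D) + z\<^sup>2 / (2 * s\<^sup>2))) / (2 * pi * (sqrt D * sqrt (2 * pi * s\<^sup>2)))"
    unfolding g n split ..
  also have "\<dots> = exp (- (Q' / (2 * D') + (z - \<mu>)\<^sup>2 / (2 * \<tau>\<^sup>2))) / (2 * pi * (sqrt D' * sqrt (2 * pi * \<tau>\<^sup>2)))"
    unfolding ex sq ..
  also have "\<dots> = gauss2 a' b' d' (x, y) * normal_density \<mu> \<tau> z"
    unfolding g n split ..
  finally show ?thesis .
qed

text \<open>Once the square is completed, \<open>z\<close> occurs only in a conditional normal
  density, which integrates to 1.\<close>

lemma nn_integral_gauss2_convolution:
  fixes v :: "real \<times> real"
  assumes "a > 0" "a * d - b\<^sup>2 > 0" "s > 0"
  shows "(\<integral>\<^sup>+z. ennreal (gauss2 a b d (w - z *\<^sub>R v)) * ennreal (normal_density 0 s z) \<partial>lborel)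
    = ennreal (gauss2 (a + (fst v)\<^sup>2 * s\<^sup>2) (b + fst v * snd v * s\<^sup>2) (d + (snd v)\<^sup>2 * s\<^sup>2) w)"
proof -
  obtain x y p r where w: "w = (x, y)" and v: "v = (p, r)" by (cases w, cases v)
  let ?D = "(a + p\<^sup>2 * s\<^sup>2) * (d + r\<^sup>2 * s\<^sup>2) - (b + p * r * s\<^sup>2)\<^sup>2"
  have D': "?D > 0" by (rule det_rank_one_update_pos[OF assms(1,2)])
  define \<mu> \<tau> where "\<mu> = (d * p * x - b * (p * y + r * x) + a * r * y) * s\<^sup>2 / ?D"
    and "\<tau> = sqrt (s\<^sup>2 * (a * d - b\<^sup>2) / ?D)"
  have "\<tau> > 0" using D' assms unfolding \<tau>_def by simp
  have "(\<integral>\<^sup>+z. ennreal (gauss2 a b d (w - z *\<^sub>R v)) * ennreal (normal_density 0 s z) \<partial>lborel)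
    = (\<integral>\<^sup>+z. ennreal (gauss2 (a + p\<^sup>2 * s\<^sup>2) (b + p * r * s\<^sup>2) (d + r\<^sup>2 * s\<^sup>2) (x, y))
              * ennreal (normal_density \<mu> \<tau> z) \<partial>lborel)"
    using gauss2_complete_square[OF assms, of x p _ y r] gauss2_nonneg[OF assms(2)]
      gauss2_nonneg[OF D']
    by (intro nn_integral_cong) (simp add: w v mult.commute \<mu>_def \<tau>_def flip: ennreal_mult)
  also have "\<dots> = ennreal (gauss2 (a + p\<^sup>2 * s\<^sup>2) (b + p * r * s\<^sup>2) (d + r\<^sup>2 * s\<^sup>2) (x, y))
      * (\<integral>\<^sup>+z. ennreal (normal_density \<mu> \<tau> z) \<partial>lborel)"
    by (rule nn_integral_cmult) simp
  also have "(\<integral>\<^sup>+z. ennreal (normal_density \<mu> \<tau> z) \<partial>lborel) = 1"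
    using \<open>\<tau> > 0\<close> by (subst nn_integral_eq_integral) auto
  finally show ?thesis by (simp add: w v)
qed

section \<open>Sums of independent Gaussian terms in the plane\<close>

text \<open>Disjoint blocks of independent variables are independent, and the product law is pushed
  forward along \<open>f\<close> and \<open>g\<close>. Independence is expressed by a product of
  laws because \<open>f\<close> and \<open>g\<close> take values in different types, whereas
  \<open>indep_var\<close> relates two variables of one type.\<close>

lemma (in prob_space) indep_vars_distr_pair:
  assumes ind: "indep_vars N X I" and AB: "A \<inter> B = {}" "A \<subseteq> I" "B \<subseteq> I"
    and f[measurable]: "f \<in> measurable (PiM A N) S" and g[measurable]: "g \<in> measurable (PiM B N) T"
  shows "distr M S (\<lambda>\<omega>. f (\<lambda>i\<in>A. X i \<omega>)) \<Otimes>\<^sub>M distr M T (\<lambda>\<omega>. g (\<lambda>i\<in>B. X i \<omega>))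
    = distr M (S \<Otimes>\<^sub>M T) (\<lambda>\<omega>. (f (\<lambda>i\<in>A. X i \<omega>), g (\<lambda>i\<in>B. X i \<omega>)))"
proof -
  define U V where "U \<omega> = (\<lambda>i\<in>A. X i \<omega>)" and "V \<omega> = (\<lambda>i\<in>B. X i \<omega>)" for \<omega>
  have "indep_var (PiM A N) U (PiM B N) V"
    unfolding U_def V_def by (rule indep_var_restrict[OF ind AB])
  then have U[measurable]: "U \<in> measurable M (PiM A N)" and V[measurable]: "V \<in> measurable M (PiM B N)"
    and eq: "distr M (PiM A N) U \<Otimes>\<^sub>M distr M (PiM B N) V = distr M (PiM A N \<Otimes>\<^sub>M PiM B N) (\<lambda>\<omega>. (U \<omega>, V \<omega>))"
    unfolding indep_var_distribution_eq by auto
  interpret gV: prob_space "distr M T (\<lambda>\<omega>. g (V \<omega>))" by (rule prob_space_distr) measurable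
  have "distr M S (\<lambda>\<omega>. f (U \<omega>)) \<Otimes>\<^sub>M distr M T (\<lambda>\<omega>. g (V \<omega>))
    = distr (distr M (PiM A N) U) S f \<Otimes>\<^sub>M distr (distr M (PiM B N) V) T g"
    by (simp add: distr_distr o_def)
  also have "\<dots> = distr (distr M (PiM A N) U \<Otimes>\<^sub>M distr M (PiM B N) V) (S \<Otimes>\<^sub>M T) (\<lambda>(x, y). (f x, g y))"
    by (rule pair_measure_distr) (simp_all add: distr_distr o_def gV.sigma_finite_measure)
  also have "\<dots> = distr M (S \<Otimes>\<^sub>M T) (\<lambda>\<omega>. (f (U \<omega>), g (V \<omega>)))"
    unfolding eq by (subst distr_distr) (simp_all add: o_def)
  finally show ?thesis unfolding U_def V_def .
qed

text \<open>By Fubini and translation invariance of Lebesgue measure the shift by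
  \<open>z *\<^sub>R v\<close> moves from the test set to the density; what remains is the
  convolution just computed.\<close>

lemma (in prob_space) distributed_gauss2_add:
  fixes X :: "'a \<Rightarrow> real \<times> real" and v :: "real \<times> real"
  assumes X: "distributed M lborel X (\<lambda>w. ennreal (gauss2 a b d w))"
    and Z: "distributed M lborel Z (\<lambda>z. ennreal (normal_density 0 s z))"
    and ind: "distr M borel X \<Otimes>\<^sub>M distr M borel Z = distr M (borel \<Otimes>\<^sub>M borel) (\<lambda>\<omega>. (X \<omega>, Z \<omega>))"
    and pos: "a > 0" "a * d - b\<^sup>2 > 0" "s > 0"
  shows "distributed M lborel (\<lambda>\<omega>. X \<omega> + Z \<omega> *\<^sub>R v) (\<lambda>w. ennreal
    (gauss2 (a + (fst v)\<^sup>2 * s\<^sup>2) (b + fst v * snd v * s\<^sup>2) (d + (snd v)\<^sup>2 * s\<^sup>2) w))"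
  (is "distributed M lborel ?Y ?g")
proof -
  have X'[measurable]: "X \<in> borel_measurable M" and Z'[measurable]: "Z \<in> borel_measurable M"
    using distributed_measurable[OF X] distributed_measurable[OF Z] by simp_all
  have sb: "sets (borel \<Otimes>\<^sub>M borel :: ((real \<times> real) \<times> real) measure) = sets (lborel \<Otimes>\<^sub>M lborel)"
    by (rule sets_pair_measure_cong) simp_all
  have "distr M lborel X \<Otimes>\<^sub>M distr M lborel Z = distr M (lborel \<Otimes>\<^sub>M lborel) (\<lambda>\<omega>. (X \<omega>, Z \<omega>))"
    using ind distr_cong[OF refl sb, of M "\<lambda>\<omega>. (X \<omega>, Z \<omega>)"]
      distr_cong[of M M borel lborel X X] distr_cong[of M M borel lborel Z Z] by simp
  then have J: "distributed M (lborel \<Otimes>\<^sub>M lborel) (\<lambda>\<omega>. (X \<omega>, Z \<omega>))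
      (\<lambda>(w, z). ennreal (gauss2 a b d w) * ennreal (normal_density 0 s z))"
    by (intro distributed_joint_indep' X Z) (auto intro: lborel.sigma_finite_measure_axioms)
  have "distr M lborel ?Y = density lborel ?g"
  proof (rule measure_eqI)
    fix A assume "A \<in> sets (distr M lborel ?Y)"
    then have [measurable]: "A \<in> sets borel" by simp
    have "emeasure (distr M lborel ?Y) A = (\<integral>\<^sup>+w. indicator A w \<partial>distr M lborel ?Y)"
      by simp
    also have "\<dots> = (\<integral>\<^sup>+\<omega>. indicator A (X \<omega> + Z \<omega> *\<^sub>R v) \<partial>M)"
      by (rule nn_integral_distr) measurable
    also have "\<dots> = (\<integral>\<^sup>+(w, z). ennreal (gauss2 a b d w) * ennreal (normal_density 0 s z)
        * indicator A (w + z *\<^sub>R v) \<partial>(lborel \<Otimes>\<^sub>M lborel))"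
      using distributed_nn_integral[OF J, of "\<lambda>(w, z). indicator A (w + z *\<^sub>R v)"]
      by (simp add: split_beta')
    also have "\<dots> = (\<integral>\<^sup>+z. \<integral>\<^sup>+w. ennreal (gauss2 a b d w) * ennreal (normal_density 0 s z)
        * indicator A (w + z *\<^sub>R v) \<partial>lborel \<partial>lborel)"
      by (subst lborel_pair.nn_integral_snd[symmetric]) auto
    also have "\<dots> = (\<integral>\<^sup>+z. \<integral>\<^sup>+w. ennreal (gauss2 a b d (w - z *\<^sub>R v)) * ennreal (normal_density 0 s z)
        * indicator A w \<partial>lborel \<partial>lborel)"
    proof (rule nn_integral_cong)
      fix z
      show "(\<integral>\<^sup>+w. ennreal (gauss2 a b d w) * ennreal (normal_density 0 s z)
          * indicator A (w + z *\<^sub>R v) \<partial>lborel) = (\<integral>\<^sup>+w. ennreal (gauss2 a b d (w - z *\<^sub>R v)) * ennreal (normal_density 0 s z)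
          * indicator A w \<partial>lborel)"
        by (subst lborel_distr_plus[symmetric, of "- (z *\<^sub>R v)"])
           (simp add: nn_integral_distr)
    qed
    also have "\<dots> = (\<integral>\<^sup>+w. \<integral>\<^sup>+z. ennreal (gauss2 a b d (w - z *\<^sub>R v)) * ennreal (normal_density 0 s z)
        * indicator A w \<partial>lborel \<partial>lborel)"
      by (subst lborel_pair.Fubini') auto
    also have "\<dots> = (\<integral>\<^sup>+w. ?g w * indicator A w \<partial>lborel)"
      by (simp add: nn_integral_multc nn_integral_gauss2_convolution[OF pos])
    also have "\<dots> = emeasure (density lborel ?g) A" by (simp add: emeasure_density)
    finally show "emeasure (distr M lborel ?Y) A = emeasure (density lborel ?g) A" .
  qed simp
  then show ?thesis unfolding distributed_def by simp
qed

section \<open>Polar coordinates with a signed radius\<close>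

text \<open>Substituting \<open>y = x * m\<close> and then
  \<open>x = r / sqrt (1 + m\<^sup>2)\<close> describes a point by the slope of its line through the
  origin and a signed radius. The sign of \<open>r\<close> separates the half planes
  \<open>x > 0\<close> and \<open>x < 0\<close>, so no branch of the angle has to be chosen.\<close>

lemma nn_integral_polar:
  fixes f :: "real \<times> real \<Rightarrow> ennreal"
  assumes [measurable]: "f \<in> borel_measurable borel"
  shows "(\<integral>\<^sup>+w. f w \<partial>lborel) = (\<integral>\<^sup>+r. \<integral>\<^sup>+m.
     f (r / sqrt (1 + m\<^sup>2), r * m / sqrt (1 + m\<^sup>2)) * ennreal (\<bar>r\<bar> / (1 + m\<^sup>2)) \<partial>lborel \<partial>lborel)"
proof -
  have "(\<integral>\<^sup>+w. f w \<partial>lborel) = (\<integral>\<^sup>+x. \<integral>\<^sup>+y. f (x, y) \<partial>lborel \<partial>lborel)"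
    unfolding lborel_prod[symmetric] by (rule lborel.nn_integral_fst[symmetric]) (simp add: lborel_prod)
  also have "\<dots> = (\<integral>\<^sup>+x. \<integral>\<^sup>+m. ennreal \<bar>x\<bar> * f (x, x * m) \<partial>lborel \<partial>lborel)"
  proof (rule nn_integral_cong_AE)
    \<comment> \<open>The vertical axis has no finite slope, but it is a null set.\<close>
    have "AE x in lborel. x \<noteq> (0::real)" by (rule AE_lborel_singleton)
    then show "AE x in lborel. (\<integral>\<^sup>+y. f (x, y) \<partial>lborel) = (\<integral>\<^sup>+m. ennreal \<bar>x\<bar> * f (x, x * m) \<partial>lborel)"
    proof eventually_elim
      fix x :: real assume "x \<noteq> 0"
      then show "(\<integral>\<^sup>+y. f (x, y) \<partial>lborel) = (\<integral>\<^sup>+m. ennreal \<bar>x\<bar> * f (x, x * m) \<partial>lborel)"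
        by (subst nn_integral_real_affine[where c = x and t = 0]) (simp_all add: nn_integral_cmult)
    qed
  qed
  also have "\<dots> = (\<integral>\<^sup>+m. \<integral>\<^sup>+x. ennreal \<bar>x\<bar> * f (x, x * m) \<partial>lborel \<partial>lborel)"
    by (subst lborel_pair.Fubini') auto
  also have "\<dots> = (\<integral>\<^sup>+m. \<integral>\<^sup>+r. f (r / sqrt (1 + m\<^sup>2), r * m / sqrt (1 + m\<^sup>2)) * ennreal (\<bar>r\<bar> / (1 + m\<^sup>2)) \<partial>lborel \<partial>lborel)"
  proof (rule nn_integral_cong)
    fix m :: real
    \<comment> \<open>\<open>c\<close> is the cosine of the angle with slope \<open>m\<close>;
      \<open>x = c * r\<close> contributes \<open>c\<close> once through \<open>dx\<close> and once
      through the factor \<open>\<bar>x\<bar>\<close>.\<close>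
    define c where "c = 1 / sqrt (1 + m\<^sup>2)"
    have pos: "1 + m\<^sup>2 > 0" by (simp add: add_pos_nonneg)
    then have c: "c > 0" "c * c = 1 / (1 + m\<^sup>2)" by (simp_all add: c_def)
    have "(\<integral>\<^sup>+x. ennreal \<bar>x\<bar> * f (x, x * m) \<partial>lborel)
       = ennreal \<bar>c\<bar> * (\<integral>\<^sup>+r. ennreal \<bar>0 + c * r\<bar> * f (0 + c * r, (0 + c * r) * m) \<partial>lborel)"
      using c by (intro nn_integral_real_affine) auto
    also have "\<dots> = (\<integral>\<^sup>+r. ennreal \<bar>c\<bar> * (ennreal \<bar>0 + c * r\<bar> * f (0 + c * r, (0 + c * r) * m)) \<partial>lborel)"
      by (rule nn_integral_cmult[symmetric]) measurable
    also have "\<dots> = (\<integral>\<^sup>+r. f (r / sqrt (1 + m\<^sup>2), r * m / sqrt (1 + m\<^sup>2)) * ennreal (\<bar>r\<bar> / (1 + m\<^sup>2)) \<partial>lborel)"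
    proof (rule nn_integral_cong)
      fix r :: real
      have "ennreal \<bar>c\<bar> * ennreal \<bar>0 + c * r\<bar> = ennreal (c * c * \<bar>r\<bar>)"
        using c(1) by (simp add: ennreal_mult[symmetric] abs_mult mult.assoc)
      then have e: "ennreal \<bar>c\<bar> * ennreal \<bar>0 + c * r\<bar> = ennreal (\<bar>r\<bar> / (1 + m\<^sup>2))" by (simp add: c)
      have "ennreal \<bar>c\<bar> * (ennreal \<bar>0 + c * r\<bar> * f (0 + c * r, (0 + c * r) * m))
         = f (0 + c * r, (0 + c * r) * m) * ennreal (\<bar>r\<bar> / (1 + m\<^sup>2))"
        unfolding e[symmetric] by (simp add: mult_ac)
      then show "ennreal \<bar>c\<bar> * (ennreal \<bar>0 + c * r\<bar> * f (0 + c * r, (0 + c * r) * m))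
         = f (r / sqrt (1 + m\<^sup>2), r * m / sqrt (1 + m\<^sup>2)) * ennreal (\<bar>r\<bar> / (1 + m\<^sup>2))"
        by (simp add: c_def)
    qed
    finally show "(\<integral>\<^sup>+x. ennreal \<bar>x\<bar> * f (x, x * m) \<partial>lborel)
      = (\<integral>\<^sup>+r. f (r / sqrt (1 + m\<^sup>2), r * m / sqrt (1 + m\<^sup>2)) * ennreal (\<bar>r\<bar> / (1 + m\<^sup>2)) \<partial>lborel)" .
  qed
  also have "\<dots> = (\<integral>\<^sup>+r. \<integral>\<^sup>+m. f (r / sqrt (1 + m\<^sup>2), r * m / sqrt (1 + m\<^sup>2)) * ennreal (\<bar>r\<bar> / (1 + m\<^sup>2)) \<partial>lborel \<partial>lborel)"
    by (subst lborel_pair.Fubini') auto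
  finally show ?thesis .
qed

section \<open>The norm of a planar Gaussian vector\<close>

text \<open>The phase is the argument of the complex number \<open>p + i r\<close>. At the origin
  any phase will do; this is the case of a double eigenvalue below.\<close>

lemma ex_phase: "\<exists>\<psi>. p = sqrt (p\<^sup>2 + r\<^sup>2) * cos \<psi> \<and> r = sqrt (p\<^sup>2 + r\<^sup>2) * sin \<psi>" for p r :: real
proof -
  have "Complex p r = cmod (Complex p r) *\<^sub>R cis (Arg (Complex p r))"
    using rcis_cmod_Arg[of "Complex p r"] by (simp add: rcis_def scaleR_conv_of_real)
  then show ?thesis
    by (intro exI[of _ "Arg (Complex p r)"]) (simp add: complex_eq_iff cmod_def)
qed

text \<open>In the direction of angle \<open>x\<close> the adjugate form is
  \<open>(l + L) / 2 - (L - l) / 2 * cos (2 * x + \<psi>)\<close>, where \<open>\<psi>\<close>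
  records the principal axes. As the angular integral does not depend on \<open>\<psi>\<close>, only
  the eigenvalues survive.\<close>

lemma nn_integral_gauss2_angular:
  fixes a b d k l L :: real
  assumes tr: "l + L = a + d" and det: "l * L = a * d - b\<^sup>2" and le: "l \<le> L"
  shows "(\<integral>\<^sup>+m. ennreal (exp (- (k * ((d - 2 * b * m + a * m\<^sup>2) / (1 + m\<^sup>2)))) / (1 + m\<^sup>2)) \<partial>lborel)
    = ennreal (exp (- (k * ((l + L) / 2))) * (pi * bessel_I0 (k * ((L - l) / 2))))"
proof -
  have "(L - l)\<^sup>2 = (l + L)\<^sup>2 - 4 * (l * L)" by (simp add: power2_eq_square algebra_simps)
  also have "\<dots> = 4 * (((a - d) / 2)\<^sup>2 + (- b)\<^sup>2)"
    unfolding tr det by (simp add: power2_eq_square field_simps)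
  finally have "((L - l) / 2)\<^sup>2 = ((a - d) / 2)\<^sup>2 + (- b)\<^sup>2" by (simp add: power_divide)
  then have rho: "sqrt (((a - d) / 2)\<^sup>2 + (- b)\<^sup>2) = (L - l) / 2"
    using le by (intro real_sqrt_unique) auto
  obtain \<psi> where \<psi>: "(a - d) / 2 = (L - l) / 2 * cos \<psi>" "- b = (L - l) / 2 * sin \<psi>"
    using ex_phase[of "(a - d) / 2" "- b"] unfolding rho by blast
  let ?h = "\<lambda>m. exp (- (k * ((d - 2 * b * m + a * m\<^sup>2) / (1 + m\<^sup>2))))"
  have h: "?h (tan x) = exp (- (k * ((l + L) / 2))) * exp (k * ((L - l) / 2) * cos (2 * x + \<psi>))"
    if "x \<in> {-(pi/2)<..<pi/2}" for x
  proof -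
    define c s where "c = cos x" and "s = sin x"
    have c: "c > 0" using that unfolding c_def by (auto intro: cos_gt_zero_pi)
    have cs: "s\<^sup>2 + c\<^sup>2 = 1" by (simp add: c_def s_def)
    have "(d - 2 * b * tan x + a * (tan x)\<^sup>2) / (1 + (tan x)\<^sup>2)
       = (d * c\<^sup>2 - 2 * b * s * c + a * s\<^sup>2) / (s\<^sup>2 + c\<^sup>2)"
      using c by (simp add: tan_def c_def s_def divide_simps) (simp add: power2_eq_square algebra_simps)
    also have "\<dots> = d * c\<^sup>2 - 2 * b * s * c + a * s\<^sup>2" by (simp add: cs)
    also have "\<dots> = (a + d) / 2 * (s\<^sup>2 + c\<^sup>2) - ((a - d) / 2 * (c\<^sup>2 - s\<^sup>2) - (- b) * (2 * s * c))"
      by (simp add: power2_eq_square field_simps)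
    also have "\<dots> = (l + L) / 2 - (L - l) / 2 * cos (2 * x + \<psi>)"
    proof -
      have "c\<^sup>2 - s\<^sup>2 = cos (2 * x)" "2 * s * c = sin (2 * x)"
        by (simp_all add: cos_double sin_double c_def s_def)
      then show ?thesis unfolding \<psi> cs tr by (simp add: cos_add algebra_simps)
    qed
    finally have e: "(d - 2 * b * tan x + a * (tan x)\<^sup>2) / (1 + (tan x)\<^sup>2)
       = (l + L) / 2 - (L - l) / 2 * cos (2 * x + \<psi>)" .
    show ?thesis unfolding e mult_exp_exp by (simp add: algebra_simps)
  qed
  have "((\<lambda>x. exp (- (k * ((l + L) / 2))) * exp (k * ((L - l) / 2) * cos (2 * x + \<psi>))) has_integral
      exp (- (k * ((l + L) / 2))) * (pi * bessel_I0 (k * ((L - l) / 2)))) {-(pi/2)<..<pi/2}"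
    using has_integral_exp_cos[of "k * ((L - l) / 2)" \<psi>]
    by (intro has_integral_mult_right) (simp add: has_integral_Icc_iff_Ioo)
  then have "((\<lambda>x. ?h (tan x)) has_integral
      exp (- (k * ((l + L) / 2))) * (pi * bessel_I0 (k * ((L - l) / 2)))) {-(pi/2)<..<pi/2}"
    by (rule has_integral_eq[rotated]) (simp only: h)
  then show ?thesis
    by (intro nn_integral_tan_substitution) auto
qed

text \<open>With \<open>q\<^sup>2 = l / L\<close> the parameters combine to \<open>l + L\<close>,
  \<open>l * L\<close> and \<open>L - l\<close>, the form in which the polar integral produces the
  density.\<close>

lemma hoyt_density_eq:
  assumes pos: "0 < l" "l \<le> L"
  shows "hoyt_density (sqrt (l / L)) (l + L) t =
    (if t < 0 then 0 else t / sqrt (l * L) * exp (- ((l + L) * t\<^sup>2 / (4 * (l * L))))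
       * bessel_I0 ((L - l) * t\<^sup>2 / (4 * (l * L))))"
proof -
  define q where "q = sqrt (l / L)"
  have L: "L > 0" using pos by simp
  have q2: "q\<^sup>2 = l / L" using pos L by (simp add: q_def)
  have q4: "q ^ 4 = (l / L)\<^sup>2" using q2 by (simp flip: q2 power_mult)
  have qL: "q * L = sqrt (l * L)"
    using pos L by (simp add: q_def real_sqrt_divide real_sqrt_mult field_simps)
  have 1: "(1 + q\<^sup>2) * t / (q * (l + L)) = t / sqrt (l * L)"
  proof -
    have "(1 + q\<^sup>2) * t / (q * (l + L)) = t / (q * L)"
      unfolding q2 using pos L by (simp add: divide_simps add.commute)
    then show ?thesis by (simp only: qL)
  qed
  have 2: "(1 + q\<^sup>2)\<^sup>2 * t\<^sup>2 / (4 * q\<^sup>2 * (l + L)) = (l + L) * t\<^sup>2 / (4 * (l * L))"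
  proof -
    have "1 + l / L = (l + L) / L" using L by (simp add: field_simps)
    moreover have "(S / L)\<^sup>2 * t\<^sup>2 / (4 * (l / L) * S) = S * t\<^sup>2 / (4 * (l * L))" if "S > 0" for S
      using pos L that by (simp add: field_simps power2_eq_square)
    ultimately show ?thesis unfolding q2 using pos L by simp
  qed
  have 3: "(1 - q ^ 4) * t\<^sup>2 / (4 * q\<^sup>2 * (l + L)) = (L - l) * t\<^sup>2 / (4 * (l * L))"
  proof -
    have "1 - (l / L)\<^sup>2 = (L - l) * (l + L) / L\<^sup>2" using L by (simp add: field_simps power2_eq_square)
    moreover have "A * S / L\<^sup>2 * t\<^sup>2 / (4 * (l / L) * S) = A * t\<^sup>2 / (4 * (l * L))" if "S > 0" for A S
      using pos L that by (simp add: field_simps power2_eq_square)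
    ultimately show ?thesis unfolding q2 q4 using pos L by simp
  qed
  show ?thesis unfolding hoyt_density_def q_def[symmetric] 1 2 3 by simp
qed

lemma hoyt_density_nonneg:
  assumes "0 < l" "l \<le> L"
  shows "0 \<le> hoyt_density (sqrt (l / L)) (l + L) t"
  using assms order_trans[OF zero_le_one bessel_I0_ge_1] unfolding hoyt_density_eq[OF assms] by auto

lemma borel_measurable_hoyt_density [measurable]: "hoyt_density q \<Omega> \<in> borel_measurable borel"
  unfolding hoyt_density_def[abs_def] by measurable

text \<open>For fixed signed radius the angular integral of the Gaussian density is a Bessel
  function, which identifies the radial density exactly, without any limit.\<close>

lemma (in prob_space) emeasure_norm_gauss2:
  assumes X: "distributed M lborel X (\<lambda>w. ennreal (gauss2 a b d w))"
    and eig: "l + L = a + d" "l * L = a * d - b\<^sup>2" and pos: "0 < l" "l \<le> L"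
  shows "emeasure M {\<omega>\<in>space M. norm (X \<omega>) \<le> t} = emeasure (hoyt (sqrt (l / L)) (l + L)) {..t}"
proof -
  define H where "H = hoyt_density (sqrt (l / L)) (l + L)"
  define D where "D = a * d - b\<^sup>2"
  have D: "D > 0" "D = l * L" using eig pos by (simp_all add: D_def flip: eig)
  have Hm[measurable]: "H \<in> borel_measurable borel" unfolding H_def by measurable
  have H0: "0 \<le> H r" for r unfolding H_def using pos by (rule hoyt_density_nonneg)
  have Hneg: "H r = 0" if "r \<le> 0" for r
    using that pos by (auto simp: H_def hoyt_density_def not_less)
  \<comment> \<open>The slopes sweep only half of the circle of radius \<open>\<bar>r\<bar>\<close>;
    hence the factor one half, recovered from \<open>r\<close> and \<open>- r\<close>.\<close>
  have rad: "(\<integral>\<^sup>+m. ennreal (gauss2 a b d (r / sqrt (1 + m\<^sup>2), r * m / sqrt (1 + m\<^sup>2)))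
      * ennreal (\<bar>r\<bar> / (1 + m\<^sup>2)) \<partial>lborel) = ennreal (H \<bar>r\<bar> / 2)" for r
  proof -
    have "(\<integral>\<^sup>+m. ennreal (gauss2 a b d (r / sqrt (1 + m\<^sup>2), r * m / sqrt (1 + m\<^sup>2)))
      * ennreal (\<bar>r\<bar> / (1 + m\<^sup>2)) \<partial>lborel)
      = (\<integral>\<^sup>+m. ennreal (\<bar>r\<bar> / (2 * pi * sqrt D)) * ennreal (exp (- (r\<^sup>2 / (2 * D) * ((d - 2 * b * m + a * m\<^sup>2) / (1 + m\<^sup>2)))) / (1 + m\<^sup>2)) \<partial>lborel)"
    proof (rule nn_integral_cong)
      fix m :: real
      have pos: "1 + m\<^sup>2 > 0" by (simp add: add_pos_nonneg)
      have sq: "(sqrt (1 + m\<^sup>2))\<^sup>2 = 1 + m\<^sup>2" using pos by simp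
      have "d * (r / sqrt (1 + m\<^sup>2))\<^sup>2 - 2 * b * (r / sqrt (1 + m\<^sup>2)) * (r * m / sqrt (1 + m\<^sup>2))
          + a * (r * m / sqrt (1 + m\<^sup>2))\<^sup>2
        = (d * r\<^sup>2 - 2 * b * r * (r * m) + a * (r * m)\<^sup>2) / (sqrt (1 + m\<^sup>2))\<^sup>2"
        by (simp add: power2_eq_square add_divide_distrib diff_divide_distrib)
      also have "\<dots> = r\<^sup>2 * ((d - 2 * b * m + a * m\<^sup>2) / (1 + m\<^sup>2))"
        unfolding sq by (simp add: power2_eq_square algebra_simps)
      finally have "gauss2 a b d (r / sqrt (1 + m\<^sup>2), r * m / sqrt (1 + m\<^sup>2))
        = exp (- (r\<^sup>2 / (2 * D) * ((d - 2 * b * m + a * m\<^sup>2) / (1 + m\<^sup>2)))) / (2 * pi * sqrt D)"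
        unfolding gauss2_def by (simp add: D_def)
      then show "ennreal (gauss2 a b d (r / sqrt (1 + m\<^sup>2), r * m / sqrt (1 + m\<^sup>2))) * ennreal (\<bar>r\<bar> / (1 + m\<^sup>2))
        = ennreal (\<bar>r\<bar> / (2 * pi * sqrt D)) * ennreal (exp (- (r\<^sup>2 / (2 * D) * ((d - 2 * b * m + a * m\<^sup>2) / (1 + m\<^sup>2)))) / (1 + m\<^sup>2))"
        using D pos by (simp add: mult_ac flip: ennreal_mult)
    qed
    also have "\<dots> = ennreal (\<bar>r\<bar> / (2 * pi * sqrt D)) * ennreal (exp (- (r\<^sup>2 / (2 * D) * ((l + L) / 2)))
         * (pi * bessel_I0 (r\<^sup>2 / (2 * D) * ((L - l) / 2))))"
      by (subst nn_integral_cmult) (simp_all only: nn_integral_gauss2_angular[OF eig pos(2)], measurable)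
    also have "\<dots> = ennreal (\<bar>r\<bar> / (2 * pi * sqrt D) * (exp (- (r\<^sup>2 / (2 * D) * ((l + L) / 2)))
         * (pi * bessel_I0 (r\<^sup>2 / (2 * D) * ((L - l) / 2)))))"
      using D order_trans[OF zero_le_one bessel_I0_ge_1] by (intro ennreal_mult[symmetric]) auto
    also have "\<bar>r\<bar> / (2 * pi * sqrt D) * (exp (- (r\<^sup>2 / (2 * D) * ((l + L) / 2)))
         * (pi * bessel_I0 (r\<^sup>2 / (2 * D) * ((L - l) / 2)))) = H \<bar>r\<bar> / 2"
      unfolding H_def hoyt_density_eq[OF pos] D(2)[symmetric] by (simp add: mult_ac)
    finally show ?thesis .
  qed
  have Xm[measurable]: "X \<in> borel_measurable M" using distributed_measurable[OF X] by simp
  have "emeasure M {\<omega>\<in>space M. norm (X \<omega>) \<le> t} = (\<integral>\<^sup>+\<omega>. indicator {\<omega>\<in>space M. norm (X \<omega>) \<le> t} \<omega> \<partial>M)"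
    by (rule nn_integral_indicator[symmetric]) measurable
  also have "\<dots> = (\<integral>\<^sup>+\<omega>. indicator {..t} (norm (X \<omega>)) \<partial>M)"
    by (intro nn_integral_cong) (auto split: split_indicator)
  also have "\<dots> = (\<integral>\<^sup>+w. ennreal (gauss2 a b d w) * indicator {..t} (norm w) \<partial>lborel)"
    by (rule distributed_nn_integral[OF X, symmetric]) measurable
  also have "\<dots> = (\<integral>\<^sup>+r. \<integral>\<^sup>+m. ennreal (gauss2 a b d (r / sqrt (1 + m\<^sup>2), r * m / sqrt (1 + m\<^sup>2)))
      * ennreal (\<bar>r\<bar> / (1 + m\<^sup>2)) * indicator {..t} \<bar>r\<bar> \<partial>lborel \<partial>lborel)"
  proof (subst nn_integral_polar, measurable, intro nn_integral_cong)
    fix r m :: real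
    have "1 + m\<^sup>2 > 0" by (simp add: add_pos_nonneg)
    then have "1 + m\<^sup>2 \<noteq> 0" by simp
    then have "r\<^sup>2 / (1 + m\<^sup>2) + (r * m)\<^sup>2 / (1 + m\<^sup>2) = r\<^sup>2"
      by (simp add: divide_simps) (simp add: power2_eq_square algebra_simps)
    then have "norm (r / sqrt (1 + m\<^sup>2), r * m / sqrt (1 + m\<^sup>2)) = \<bar>r\<bar>"
      by (simp add: norm_Pair power_divide flip: real_sqrt_abs)
    then show "ennreal (gauss2 a b d (r / sqrt (1 + m\<^sup>2), r * m / sqrt (1 + m\<^sup>2))) *
           indicator {..t} (norm (r / sqrt (1 + m\<^sup>2), r * m / sqrt (1 + m\<^sup>2))) * ennreal (\<bar>r\<bar> / (1 + m\<^sup>2)) =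
           ennreal (gauss2 a b d (r / sqrt (1 + m\<^sup>2), r * m / sqrt (1 + m\<^sup>2)))
      * ennreal (\<bar>r\<bar> / (1 + m\<^sup>2)) * indicator {..t} \<bar>r\<bar>" by (simp add: mult_ac)
  qed
  also have "\<dots> = (\<integral>\<^sup>+r. ennreal (H \<bar>r\<bar> / 2) * indicator {..t} \<bar>r\<bar> \<partial>lborel)"
  proof (rule nn_integral_cong)
    fix r :: real
    show "(\<integral>\<^sup>+m. ennreal (gauss2 a b d (r / sqrt (1 + m\<^sup>2), r * m / sqrt (1 + m\<^sup>2)))
      * ennreal (\<bar>r\<bar> / (1 + m\<^sup>2)) * indicator {..t} \<bar>r\<bar> \<partial>lborel) = ennreal (H \<bar>r\<bar> / 2) * indicator {..t} \<bar>r\<bar>"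
      unfolding rad[symmetric] by (rule nn_integral_multc) (auto intro!: borel_measurable_times_ennreal measurable_compose[OF _ borel_measurable_gauss2[THEN measurable_compose[OF _ measurable_ennreal]]])
  qed
  \<comment> \<open>\<open>H\<close> vanishes on nonpositive arguments, so at most one summand is
    nonzero and \<open>r = 0\<close> is not counted twice.\<close>
  also have "\<dots> = (\<integral>\<^sup>+r. ennreal (H r / 2) * indicator {..t} r + ennreal (H (0 + (-1) * r) / 2) * indicator {..t} (0 + (-1) * r) \<partial>lborel)"
    by (intro nn_integral_cong) (auto simp: abs_if Hneg split: split_indicator)
  also have "\<dots> = (\<integral>\<^sup>+r. ennreal (H r / 2) * indicator {..t} r \<partial>lborel)
      + (\<integral>\<^sup>+r. ennreal (H (0 + (-1) * r) / 2) * indicator {..t} (0 + (-1) * r) \<partial>lborel)"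
    by (rule nn_integral_add) measurable
  also have "(\<integral>\<^sup>+r. ennreal (H (0 + (-1) * r) / 2) * indicator {..t} (0 + (-1) * r) \<partial>lborel)
     = (\<integral>\<^sup>+r. ennreal (H r / 2) * indicator {..t} r \<partial>lborel)"
    using nn_integral_real_affine[of "\<lambda>r. ennreal (H r / 2) * indicator {..t} r" "-1" 0] by simp
  also have "(\<integral>\<^sup>+r. ennreal (H r / 2) * indicator {..t} r \<partial>lborel) + (\<integral>\<^sup>+r. ennreal (H r / 2) * indicator {..t} r \<partial>lborel)
    = (\<integral>\<^sup>+r. ennreal (H r) * indicator {..t} r \<partial>lborel)"
    by (subst nn_integral_add[symmetric])
       (auto intro!: nn_integral_cong simp: H0 simp flip: ennreal_plus split: split_indicator)
  also have "\<dots> = emeasure (hoyt (sqrt (l / L)) (l + L)) {..t}"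
    by (simp add: hoyt_def emeasure_density H_def)
  finally show ?thesis .
qed

section \<open>A bound on the Hoyt density that is uniform in q\<close>

text \<open>Jordan's inequality: by concavity the sine lies above its chord from 0 to
  \<open>pi / 2\<close>.\<close>

lemma sin_ge_chord:
  assumes "0 \<le> x" "x \<le> pi / 2"
  shows "2 * x / pi \<le> sin x"
proof -
  have "convex_on {0..pi/2} (\<lambda>x. - sin x)"
  proof (rule f''_ge0_imp_convex)
    show "((\<lambda>x. - sin x) has_real_derivative - cos x) (at x)" for x by (auto intro!: derivative_eq_intros)
    show "((\<lambda>x. - cos x) has_real_derivative sin x) (at x)" for x by (auto intro!: derivative_eq_intros)
    show "0 \<le> sin x" if "x \<in> {0..pi/2}" for x using that by (auto intro: sin_ge_zero)
  qed simp
  then have "- sin ((1 - 2 * x / pi) *\<^sub>R 0 + (2 * x / pi) *\<^sub>R (pi / 2)) \<le> (1 - 2 * x / pi) * - sin 0 + 2 * x / pi * - sin (pi / 2)"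
    by (rule convex_onD) (use assms in \<open>auto simp: field_simps\<close>)
  then show ?thesis by simp
qed

lemma one_minus_cos_double_ge:
  assumes "x \<in> {-(pi/2)..pi/2}"
  shows "1 - cos (2 * x) \<ge> 8 * x\<^sup>2 / pi\<^sup>2"
proof -
  have "2 * \<bar>x\<bar> / pi \<le> \<bar>sin x\<bar>"
    using sin_ge_chord[of "\<bar>x\<bar>"] assms by (auto simp: abs_if split: if_splits)
  then have "(2 * \<bar>x\<bar> / pi)\<^sup>2 \<le> \<bar>sin x\<bar>\<^sup>2" by (intro power_mono) auto
  then show ?thesis by (simp add: cos_double_sin power_divide power_mult_distrib)
qed

lemma has_integral_normal_density:
  assumes "\<sigma> > 0" shows "(normal_density \<mu> \<sigma> has_integral 1) UNIV"
  using assms by (intro nn_integral_has_integral) (auto simp: nn_integral_eq_integral)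

text \<open>The factor \<open>t / sqrt (l * L)\<close> explodes as \<open>l\<close> tends to 0, but
  the angular integrand then concentrates at angle 0 with width of order \<open>sqrt l / t\<close>.
  A Gaussian majorant captures this width, and \<open>l\<close> and \<open>t\<close> cancel.\<close>

lemma hoyt_density_le:
  assumes pos: "0 < l" "l \<le> L"
  shows "hoyt_density (sqrt (l / L)) (l + L) t \<le> 2 / sqrt (l + L)"
proof (cases "t > 0")
  case False
  then have "hoyt_density (sqrt (l / L)) (l + L) t = 0"
    using pos by (cases "t = 0") (auto simp: hoyt_density_def)
  then show ?thesis using pos by simp
next
  case t: True
  define k where "k = t\<^sup>2 / (4 * (l * L))"
  \<comment> \<open>Chosen so that \<open>1 / (2 * s\<^sup>2) = 8 * k * L / pi\<^sup>2\<close>, the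
    curvature supplied by \<open>one_minus_cos_double_ge\<close>.\<close>
  define s where "s = pi * sqrt l / (2 * t)"
  have L: "L > 0" and k: "k > 0" and s: "s > 0" using pos t by (auto simp: k_def s_def)
  have s2: "2 * s\<^sup>2 = pi\<^sup>2 * l / (2 * t\<^sup>2)" using pos by (simp add: s_def power_divide power_mult_distrib)
  let ?J = "exp (- ((l + L) * k)) * (pi * bessel_I0 ((L - l) * k))"
  have J: "((\<lambda>x. exp (- ((l + L) * k)) * exp ((L - l) * k * cos (2 * x + 0))) has_integral ?J) {-(pi/2)..pi/2}"
    by (intro has_integral_mult_right has_integral_exp_cos)
  have G: "((\<lambda>x. sqrt (2 * pi * s\<^sup>2) * normal_density 0 s x) has_integral sqrt (2 * pi * s\<^sup>2) * 1) UNIV"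
    by (intro has_integral_mult_right has_integral_normal_density s)
  have "?J \<le> sqrt (2 * pi * s\<^sup>2) * 1"
  proof (rule has_integral_le[OF J[THEN has_integral_restrict_UNIV[THEN iffD2]] G])
    fix x :: real
    have "exp (- ((l + L) * k)) * exp ((L - l) * k * cos (2 * x + 0)) \<le> sqrt (2 * pi * s\<^sup>2) * normal_density 0 s x"
      if x: "x \<in> {-(pi/2)..pi/2}"
    proof -
    have c: "0 \<le> 1 + cos (2 * x)" using cos_ge_minus_one[of "2 * x"] by linarith
    \<comment> \<open>The exponent splits along the two axes; the part of the smaller eigenvalue is
      nonnegative and is dropped.\<close>
    have "L * (8 * x\<^sup>2 / pi\<^sup>2) \<le> L * (1 - cos (2 * x)) + l * (1 + cos (2 * x))"
    proof (rule add_increasing2)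
      show "0 \<le> l * (1 + cos (2 * x))" using c pos by simp
      show "L * (8 * x\<^sup>2 / pi\<^sup>2) \<le> L * (1 - cos (2 * x))"
        using one_minus_cos_double_ge[OF x] L by (intro mult_left_mono) auto
    qed
    also have "\<dots> = (l + L) - (L - l) * cos (2 * x)" by (simp add: algebra_simps)
    finally have "k * (L * (8 * x\<^sup>2 / pi\<^sup>2)) \<le> k * ((l + L) - (L - l) * cos (2 * x))"
      using k by (intro mult_left_mono) auto
    also have "k * (L * (8 * x\<^sup>2 / pi\<^sup>2)) = x\<^sup>2 / (2 * s\<^sup>2)"
      unfolding s2 k_def using pos L t by (simp add: field_simps)
    finally have "- ((l + L) * k) + (L - l) * k * cos (2 * x) \<le> - (x\<^sup>2 / (2 * s\<^sup>2))"
      by (simp add: algebra_simps)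
    then show ?thesis
      using s by (simp add: mult_exp_exp normal_density_def)
    qed
    then show "(if x \<in> {-(pi/2)..pi/2} then exp (- ((l + L) * k)) * exp ((L - l) * k * cos (2 * x + 0)) else 0)
        \<le> sqrt (2 * pi * s\<^sup>2) * normal_density 0 s x"
      by simp
  qed
  then have J_le: "?J \<le> sqrt (2 * pi) * s" using s by (simp add: real_sqrt_mult)
  have "hoyt_density (sqrt (l / L)) (l + L) t = t / sqrt (l * L) / pi * ?J"
    unfolding hoyt_density_eq[OF pos] using t by (simp add: k_def)
  also have "\<dots> \<le> t / sqrt (l * L) / pi * (sqrt (2 * pi) * s)"
    using t pos L by (intro mult_left_mono J_le) auto
  also have "\<dots> = sqrt (2 * pi) / (2 * sqrt L)"
    using pos L t by (simp add: s_def real_sqrt_mult)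
  also have "\<dots> = sqrt pi / sqrt (2 * L)"
  proof (subst frac_eq_eq)
    show "sqrt (2 * pi) * sqrt (2 * L) = sqrt pi * (2 * sqrt L)"
      by (simp add: real_sqrt_mult)
  qed (use L in auto)
  \<comment> \<open>Here \<open>l + L \<le> 2 * L\<close> and \<open>pi < 4\<close> enter; this is
    the origin of the constant 2.\<close>
  also have "\<dots> \<le> 2 / sqrt (l + L)"
  proof (rule frac_le)
    have "sqrt pi \<le> sqrt 4" using pi_less_4 by (intro real_sqrt_le_mono) simp
    then show "sqrt pi \<le> 2" by simp
  qed (use pos in auto)
  finally show ?thesis .
qed

lemma emeasure_hoyt_interval_le:
  assumes pos: "0 < l" "l \<le> L" and "s \<le> t"
  shows "emeasure (hoyt (sqrt (l / L)) (l + L)) {s<..t} \<le> ennreal (2 / sqrt (l + L) * (t - s))"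
proof -
  have "emeasure (hoyt (sqrt (l / L)) (l + L)) {s<..t}
    = (\<integral>\<^sup>+x. ennreal (hoyt_density (sqrt (l / L)) (l + L) x) * indicator {s<..t} x \<partial>lborel)"
    by (simp add: hoyt_def emeasure_density)
  also have "\<dots> \<le> (\<integral>\<^sup>+x. ennreal (2 / sqrt (l + L)) * indicator {s<..t} x \<partial>lborel)"
    using hoyt_density_le[OF pos] by (intro nn_integral_mono mult_right_mono ennreal_leI) auto
  also have "\<dots> = ennreal (2 / sqrt (l + L)) * ennreal (t - s)"
    using \<open>s \<le> t\<close> by (simp add: nn_integral_cmult_indicator)
  also have "\<dots> = ennreal (2 / sqrt (l + L) * (t - s))"
    using assms by (intro ennreal_mult[symmetric]) auto
  finally show ?thesis .
qed

section \<open>The covariance matrix\<close>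

lemma det_mat_2:
  assumes A: "(A :: 'a :: comm_ring_1 mat) \<in> carrier_mat 2 2"
  shows "Determinant.det A = A $$ (0, 0) * A $$ (1, 1) - A $$ (0, 1) * A $$ (1, 0)"
proof -
  have "mat_delete A 0 j \<in> carrier_mat 1 1" for j
    using mat_delete_carrier[OF A, of 0 j] by simp
  from det_single[OF this] have "cofactor A 0 j = (-1) ^ j * mat_delete A 0 j $$ (0, 0)" for j
    by (simp add: cofactor_def)
  then show ?thesis
    using A by (simp add: laplace_expansion_row[OF A, of 0] mat_delete_def numeral_2_eq_2)
qed

lemma eigenvalue_mat_2:
  "eigenvalue (mat_of_rows_list 2 [[a, b], [b, d]]) k \<longleftrightarrow> k\<^sup>2 - (a + d) * k + (a * d - b\<^sup>2) = (0::real)"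
proof -
  let ?A = "mat_of_rows_list 2 [[a, b], [b, d]]"
  have A: "?A \<in> carrier_mat 2 2" by (simp add: mat_of_rows_list_def carrier_matI)
  have "char_matrix ?A k \<in> carrier_mat 2 2" using A by simp
  from det_mat_2[OF this] have det: "Determinant.det (char_matrix ?A k) = (a - k) * (d - k) - b * b"
    by (simp add: char_matrix_def mat_of_rows_list_def)
  show ?thesis
    unfolding eigenvalue_det[OF A] det by (simp add: power2_eq_square algebra_simps)
qed

text \<open>Vieta's formulas from a root set that forgets multiplicity. Besides \<open>l1\<close>
  the other root is \<open>\<tau> - l1\<close>; membership of \<open>\<tau> - l1\<close> and of
  \<open>l2\<close> in the root set also settles the case of a double root.\<close>

lemma quadratic_root_set:
  fixes l1 l2 \<tau> D :: real
  assumes "{k. k\<^sup>2 - \<tau> * k + D = 0} = {l1, l2}"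
  shows "l1 + l2 = \<tau>" "l1 * l2 = D"
proof -
  have r: "k\<^sup>2 - \<tau> * k + D = 0 \<longleftrightarrow> k = l1 \<or> k = l2" for k using assms by blast
  have D: "D = l1 * (\<tau> - l1)" using r[of l1] by (simp add: power2_eq_square algebra_simps)
  have f: "k\<^sup>2 - \<tau> * k + D = (k - l1) * (k - (\<tau> - l1))" for k
    unfolding D by (simp add: power2_eq_square algebra_simps)
  have "\<tau> - l1 = l1 \<or> \<tau> - l1 = l2" using r[of "\<tau> - l1"] unfolding f by simp
  moreover have "l2 = l1 \<or> l2 = \<tau> - l1" using r[of l2] unfolding f by simp
  ultimately show "l1 + l2 = \<tau>" by auto
  then show "l1 * l2 = D" unfolding D by auto
qed

section \<open>The law of the linear Gaussian vector\<close>

lemma (in prob_space) indep_vars_distr_pair_component: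
  assumes ind: "indep_vars (\<lambda>_. borel) e UNIV" and f: "f \<in> measurable (PiM A (\<lambda>_. borel)) S"
    and "s \<notin> A" and X: "\<And>\<omega>. X \<omega> = f (\<lambda>i\<in>A. e i \<omega>)"
  shows "distr M S X \<Otimes>\<^sub>M distr M borel (e s) = distr M (S \<Otimes>\<^sub>M borel) (\<lambda>\<omega>. (X \<omega>, e s \<omega>))"
proof -
  have "distr M S (\<lambda>\<omega>. f (\<lambda>i\<in>A. e i \<omega>)) \<Otimes>\<^sub>M distr M borel (\<lambda>\<omega>. (\<lambda>x. x s) (\<lambda>i\<in>{s}. e i \<omega>))
    = distr M (S \<Otimes>\<^sub>M borel) (\<lambda>\<omega>. (f (\<lambda>i\<in>A. e i \<omega>), (\<lambda>x. x s) (\<lambda>i\<in>{s}. e i \<omega>)))"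
    using \<open>s \<notin> A\<close> by (intro indep_vars_distr_pair[OF ind] f measurable_component_singleton) auto
  moreover have "(\<lambda>x. x s) (\<lambda>i\<in>{s}. e i \<omega>) = e s \<omega>" for \<omega> by simp
  moreover have "(\<lambda>\<omega>. f (\<lambda>i\<in>A. e i \<omega>)) = X" by (simp add: X fun_eq_iff)
  ultimately show ?thesis by (simp only: X[symmetric])
qed

text \<open>Starting with \<open>(e SY, e SZ)\<close> gives a diagonal positive definite covariance.
  Each further source is a rank-one update that keeps it definite, so a density exists at every
  stage although a single column \<open>u\<close>, \<open>v\<close> or \<open>w\<close> carries only
  a degenerate law.\<close>

lemma (in prob_space) distributed_gaussian_combination:
  fixes e :: "source \<Rightarrow> 'a \<Rightarrow> real" and u v w :: "real \<times> real"
  assumes ind: "indep_vars (\<lambda>_. borel) e UNIV"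
    and dist: "\<And>s. distributed M lborel (e s) (\<lambda>x. ennreal (normal_density 0 (\<sigma> s) x))"
    and pos: "\<And>s. \<sigma> s > 0"
  defines "a \<equiv> (\<sigma> SY)\<^sup>2 + (fst u)\<^sup>2 * (\<sigma> SPhi)\<^sup>2 + (fst v)\<^sup>2 * (\<sigma> SX)\<^sup>2 + (fst w)\<^sup>2 * (\<sigma> STheta)\<^sup>2"
    and "b \<equiv> fst u * snd u * (\<sigma> SPhi)\<^sup>2 + fst v * snd v * (\<sigma> SX)\<^sup>2 + fst w * snd w * (\<sigma> STheta)\<^sup>2"
    and "d \<equiv> (\<sigma> SZ)\<^sup>2 + (snd u)\<^sup>2 * (\<sigma> SPhi)\<^sup>2 + (snd v)\<^sup>2 * (\<sigma> SX)\<^sup>2 + (snd w)\<^sup>2 * (\<sigma> STheta)\<^sup>2"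
  shows "distributed M lborel
      (\<lambda>\<omega>. (e SY \<omega>, e SZ \<omega>) + e SPhi \<omega> *\<^sub>R u + e SX \<omega> *\<^sub>R v + e STheta \<omega> *\<^sub>R w)
      (\<lambda>x. ennreal (gauss2 a b d x))"
    and "a > 0" and "a * d - b\<^sup>2 > 0"
proof -
  note sf = lborel.sigma_finite_measure_axioms
  have em[measurable]: "e s \<in> borel_measurable M" for s using distributed_measurable[OF dist[of s]] by simp
  define X0 where "X0 \<omega> = (e SY \<omega>, e SZ \<omega>)" for \<omega>
  define X1 where "X1 \<omega> = X0 \<omega> + e SPhi \<omega> *\<^sub>R u" for \<omega>
  define X2 where "X2 \<omega> = X1 \<omega> + e SX \<omega> *\<^sub>R v" for \<omega>
  have proj[measurable]: "s \<in> A \<Longrightarrow> (\<lambda>x. x s) \<in> borel_measurable (Pi\<^sub>M A (\<lambda>_. borel :: real measure))"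
    for s :: source and A by (rule measurable_component_singleton)
  define a0 b0 d0 where "a0 = (\<sigma> SY)\<^sup>2" and "b0 = (0::real)" and "d0 = (\<sigma> SZ)\<^sup>2"
  define a1 b1 d1 where "a1 = a0 + (fst u)\<^sup>2 * (\<sigma> SPhi)\<^sup>2"
    and "b1 = b0 + fst u * snd u * (\<sigma> SPhi)\<^sup>2" and "d1 = d0 + (snd u)\<^sup>2 * (\<sigma> SPhi)\<^sup>2"
  define a2 b2 d2 where "a2 = a1 + (fst v)\<^sup>2 * (\<sigma> SX)\<^sup>2"
    and "b2 = b1 + fst v * snd v * (\<sigma> SX)\<^sup>2" and "d2 = d1 + (snd v)\<^sup>2 * (\<sigma> SX)\<^sup>2"
  have abd: "a = a2 + (fst w)\<^sup>2 * (\<sigma> STheta)\<^sup>2" "b = b2 + fst w * snd w * (\<sigma> STheta)\<^sup>2"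
    "d = d2 + (snd w)\<^sup>2 * (\<sigma> STheta)\<^sup>2"
    by (simp_all add: a_def b_def d_def a2_def b2_def d2_def a1_def b1_def d1_def a0_def b0_def d0_def)
  have p0: "a0 > 0" "a0 * d0 - b0\<^sup>2 > 0"
    using pos[of SY] pos[of SZ] by (simp_all add: a0_def b0_def d0_def)
  have rank_one_pos: "a + p\<^sup>2 * s\<^sup>2 > 0" "(a + p\<^sup>2 * s\<^sup>2) * (d + r\<^sup>2 * s\<^sup>2) - (b + p * r * s\<^sup>2)\<^sup>2 > 0"
    if "a > 0" "a * d - b\<^sup>2 > 0" for a b d p r s :: real
    using that(1) det_rank_one_update_pos[OF that] by (simp_all only: add_pos_nonneg zero_le_power2 mult_nonneg_nonneg)
  have p1: "a1 > 0" "a1 * d1 - b1\<^sup>2 > 0"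
    unfolding a1_def b1_def d1_def using rank_one_pos[OF p0] .
  have p2: "a2 > 0" "a2 * d2 - b2\<^sup>2 > 0"
    unfolding a2_def b2_def d2_def using rank_one_pos[OF p1] .
  show "a > 0" "a * d - b\<^sup>2 > 0"
    unfolding abd using rank_one_pos[OF p2] .

  have "distr M borel (e SY) \<Otimes>\<^sub>M distr M borel (e SZ) = distr M (borel \<Otimes>\<^sub>M borel) (\<lambda>\<omega>. (e SY \<omega>, e SZ \<omega>))"
    by (rule indep_vars_distr_pair_component[OF ind proj[of SY "{SY}"]]) simp_all
  moreover have "distr M lborel (e s) = distr M borel (e s)" for s by (rule distr_cong) simp_all
  moreover have "distr M (lborel \<Otimes>\<^sub>M lborel) (\<lambda>\<omega>. (e SY \<omega>, e SZ \<omega>)) = distr M (borel \<Otimes>\<^sub>M borel) (\<lambda>\<omega>. (e SY \<omega>, e SZ \<omega>))"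
    by (intro distr_cong sets_pair_measure_cong) simp_all
  ultimately have "distr M lborel (e SY) \<Otimes>\<^sub>M distr M lborel (e SZ) = distr M (lborel \<Otimes>\<^sub>M lborel) (\<lambda>\<omega>. (e SY \<omega>, e SZ \<omega>))"
    by (simp only:)
  from distributed_joint_indep'[OF sf sf dist dist this]
  have "distributed M lborel X0 (\<lambda>(x, y). ennreal (normal_density 0 (\<sigma> SY) x) * ennreal (normal_density 0 (\<sigma> SZ) y))"
    unfolding lborel_prod X0_def .
  moreover have "(\<lambda>(x, y). ennreal (normal_density 0 (\<sigma> SY) x) * ennreal (normal_density 0 (\<sigma> SZ) y))
    = (\<lambda>x. ennreal (gauss2 a0 b0 d0 x))"
    using gauss2_diag[OF pos[of SY] pos[of SZ]]
    by (auto simp: fun_eq_iff a0_def b0_def d0_def ennreal_mult)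
  ultimately have D0: "distributed M lborel X0 (\<lambda>x. ennreal (gauss2 a0 b0 d0 x))" by simp
  have "distributed M lborel X1 (\<lambda>x. ennreal (gauss2 a1 b1 d1 x))"
    unfolding X1_def a1_def b1_def d1_def
  proof (rule distributed_gauss2_add[OF D0 dist _ p0 pos])
    show "distr M borel X0 \<Otimes>\<^sub>M distr M borel (e SPhi) = distr M (borel \<Otimes>\<^sub>M borel) (\<lambda>\<omega>. (X0 \<omega>, e SPhi \<omega>))"
      by (rule indep_vars_distr_pair_component[OF ind borel_measurable_Pair[OF proj[of SY "{SY, SZ}"] proj[of SZ]]])
         (simp_all add: X0_def)
  qed
  note D1 = this
  have "distributed M lborel X2 (\<lambda>x. ennreal (gauss2 a2 b2 d2 x))"
    unfolding X2_def a2_def b2_def d2_def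
  proof (rule distributed_gauss2_add[OF D1 dist _ p1 pos])
    have f: "(\<lambda>x. (x SY, x SZ) + x SPhi *\<^sub>R u) \<in> borel_measurable (Pi\<^sub>M {SY, SZ, SPhi} (\<lambda>_. borel))"
      by (intro borel_measurable_add borel_measurable_scaleR borel_measurable_Pair proj) auto
    show "distr M borel X1 \<Otimes>\<^sub>M distr M borel (e SX) = distr M (borel \<Otimes>\<^sub>M borel) (\<lambda>\<omega>. (X1 \<omega>, e SX \<omega>))"
      by (rule indep_vars_distr_pair_component[OF ind f]) (simp_all add: X0_def X1_def)
  qed
  note D2 = this
  have "distributed M lborel (\<lambda>\<omega>. X2 \<omega> + e STheta \<omega> *\<^sub>R w) (\<lambda>x. ennreal (gauss2 a b d x))"
    unfolding abd
  proof (rule distributed_gauss2_add[OF D2 dist _ p2 pos])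
    have f: "(\<lambda>x. (x SY, x SZ) + x SPhi *\<^sub>R u + x SX *\<^sub>R v) \<in> borel_measurable (Pi\<^sub>M {SY, SZ, SPhi, SX} (\<lambda>_. borel))"
      by (intro borel_measurable_add borel_measurable_scaleR borel_measurable_Pair proj) auto
    show "distr M borel X2 \<Otimes>\<^sub>M distr M borel (e STheta) = distr M (borel \<Otimes>\<^sub>M borel) (\<lambda>\<omega>. (X2 \<omega>, e STheta \<omega>))"
      by (rule indep_vars_distr_pair_component[OF ind f]) (simp_all add: X0_def X1_def X2_def)
  qed
  then show "distributed M lborel
      (\<lambda>\<omega>. (e SY \<omega>, e SZ \<omega>) + e SPhi \<omega> *\<^sub>R u + e SX \<omega> *\<^sub>R v + e STheta \<omega> *\<^sub>R w)
      (\<lambda>x. ennreal (gauss2 a b d x))"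
    by (simp add: X0_def X1_def X2_def)
qed

section \<open>Comparison of distribution functions and local linearisation\<close>

lemma (in prob_space) normal_tail_le:
  assumes dist: "distributed M lborel X (\<lambda>x. ennreal (normal_density 0 \<sigma> x))" and "\<sigma> > 0" "c > 0"
  shows "prob {\<omega>\<in>space M. c \<le> \<bar>X \<omega>\<bar>} \<le> \<sigma>\<^sup>2 / c\<^sup>2"
proof -
  have [measurable]: "X \<in> borel_measurable M" using distributed_measurable[OF dist] by simp
  have E: "expectation X = 0" using dist \<open>\<sigma> > 0\<close> by (rule normal_distributed_expectation[rotated])
  have V: "variance X = \<sigma>\<^sup>2" using dist \<open>\<sigma> > 0\<close> by (rule normal_distributed_variance[rotated])
  have "integrable M (\<lambda>\<omega>. (X \<omega>)\<^sup>2)"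
    using distributed_integrable[OF dist, of "\<lambda>x. x\<^sup>2"] integrable_normal_moment[OF \<open>\<sigma> > 0\<close>, of 0 2] by simp
  from Chebyshev_inequality[OF _ this \<open>c > 0\<close>] show ?thesis using V by (simp add: E)
qed

text \<open>Outside the exceptional event, \<open>U \<le> t\<close> implies
  \<open>V \<le> t + h\<close> and is implied by \<open>V \<le> t - h\<close>. Shifting the
  threshold by \<open>h\<close> changes the probability for \<open>V\<close> by at most
  \<open>C * h\<close>.\<close>

lemma (in prob_space) cdf_sandwich:
  fixes U V :: "'a \<Rightarrow> real" and N :: "real measure"
  assumes U[measurable]: "U \<in> borel_measurable M" and V[measurable]: "V \<in> borel_measurable M"
    and N: "\<And>t. emeasure M {\<omega>\<in>space M. V \<omega> \<le> t} = emeasure N {..t}" and sets: "sets N = sets borel"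
    and conc: "\<And>s t. s \<le> t \<Longrightarrow> emeasure N {s<..t} \<le> ennreal (C * (t - s))"
    and pos: "0 \<le> C" "0 \<le> h"
    and close: "prob {\<omega>\<in>space M. h < \<bar>U \<omega> - V \<omega>\<bar>} \<le> p"
  shows "\<bar>prob {\<omega>\<in>space M. U \<omega> \<le> t} - cdf N t\<bar> \<le> p + C * h"
proof -
  have cdf: "cdf N t = prob {\<omega>\<in>space M. V \<omega> \<le> t}" for t
    unfolding cdf_def measure_def N ..
  have step: "prob {\<omega>\<in>space M. V \<omega> \<le> s + h} \<le> prob {\<omega>\<in>space M. V \<omega> \<le> s} + C * h" for s
  proof -
    have "ennreal (prob {\<omega>\<in>space M. V \<omega> \<le> s + h}) = emeasure N {..s + h}"
      by (simp add: N flip: emeasure_eq_measure)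
    also have "{..s + h} = {..s} \<union> {s<..s + h}" using pos by auto
    also have "emeasure N ({..s} \<union> {s<..s + h}) \<le> emeasure N {..s} + emeasure N {s<..s + h}"
      by (rule emeasure_subadditive) (simp_all add: sets)
    also have "\<dots> \<le> emeasure N {..s} + ennreal (C * h)"
      using conc[of s "s + h"] pos by (intro add_left_mono) simp
    also have "emeasure N {..s} = ennreal (prob {\<omega>\<in>space M. V \<omega> \<le> s})"
      by (simp add: N flip: emeasure_eq_measure)
    finally show ?thesis using pos by (simp add: ennreal_le_iff flip: ennreal_plus)
  qed
  have close_le: "prob A \<le> prob B + p"
    if "A \<subseteq> B \<union> {\<omega>\<in>space M. h < \<bar>U \<omega> - V \<omega>\<bar>}" and [measurable]: "A \<in> events" "B \<in> events" for A B
  proof -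
    have "prob A \<le> prob (B \<union> {\<omega>\<in>space M. h < \<bar>U \<omega> - V \<omega>\<bar>})"
      by (rule finite_measure_mono[OF that(1)]) measurable
    also have "\<dots> \<le> prob B + prob {\<omega>\<in>space M. h < \<bar>U \<omega> - V \<omega>\<bar>}"
      by (rule measure_Un_le) measurable
    finally show ?thesis using close by simp
  qed
  have "prob {\<omega>\<in>space M. U \<omega> \<le> t} \<le> prob {\<omega>\<in>space M. V \<omega> \<le> t + h} + p"
    by (rule close_le) auto
  moreover have "prob {\<omega>\<in>space M. V \<omega> \<le> t - h} \<le> prob {\<omega>\<in>space M. U \<omega> \<le> t} + p"
    by (rule close_le) auto
  ultimately show ?thesis using step[of t] step[of "t - h"] unfolding cdf by auto
qed

text \<open>The remainder is \<open>c * (g (w + v) - g w - g' v) + x * (g (w + v) - g w)\<close>.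
  Both terms are small relative to \<open>v\<close>, so the bound contains no multiple of
  \<open>\<bar>x\<bar>\<close> alone.\<close>

lemma product_linearization:
  fixes g :: "'b::real_normed_vector \<Rightarrow> real"
  assumes g: "(g has_derivative g') (at w)" and "\<eta> > 0"
  obtains \<rho> where "\<rho> > 0"
    "\<And>(v::'b) x. norm v < \<rho> \<Longrightarrow> \<bar>x\<bar> < \<rho> \<Longrightarrow>
      \<bar>(c + x) * g (w + v) - c * g w - (x * g w + c * g' v)\<bar> \<le> \<eta> * norm v"
proof -
  interpret g': bounded_linear g' by (rule has_derivative_bounded_linear[OF g])
  obtain K where K: "K > 0" "\<And>v. norm (g' v) \<le> norm v * K" using g'.pos_bounded by blast
  \<comment> \<open>Each of the two remainder terms may use \<open>\<eta> / 2\<close>; adding 1 to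
    \<open>\<bar>c\<bar>\<close> covers \<open>c = 0\<close>.\<close>
  define \<eta>' where "\<eta>' = \<eta> / (2 * (\<bar>c\<bar> + 1))"
  have \<eta>': "\<eta>' > 0" "\<bar>c\<bar> * \<eta>' \<le> \<eta> / 2"
    using \<open>\<eta> > 0\<close> by (auto simp: \<eta>'_def divide_simps mult_left_mono)
  obtain \<rho>1 where \<rho>1: "\<rho>1 > 0" "\<And>y. norm (y - w) < \<rho>1 \<Longrightarrow> norm (g y - g w - g' (y - w)) \<le> \<eta>' * norm (y - w)"
    using g \<eta>'(1) unfolding has_derivative_at_alt by blast
  \<comment> \<open>Within \<open>\<rho>1\<close> the increment of \<open>g\<close> is at most
    \<open>(K + \<eta>') * norm v\<close>, so the second bound on \<open>x\<close> makes the product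
    at most \<open>\<eta> / 2 * norm v\<close>.\<close>
  define \<rho> where "\<rho> = min \<rho>1 (\<eta> / (2 * (K + \<eta>')))"
  show thesis
  proof (rule that)
    show "\<rho> > 0" using \<rho>1 \<open>\<eta> > 0\<close> \<eta>' K by (simp add: \<rho>_def)
    fix v :: 'b and x assume v: "norm v < \<rho>" and x: "\<bar>x\<bar> < \<rho>"
    have r: "\<bar>g (w + v) - g w - g' v\<bar> \<le> \<eta>' * norm v"
      using \<rho>1(2)[of "w + v"] v by (simp add: \<rho>_def)
    have "\<bar>g (w + v) - g w\<bar> \<le> \<bar>g (w + v) - g w - g' v\<bar> + \<bar>g' v\<bar>" by simp
    also have "\<dots> \<le> (K + \<eta>') * norm v" using r K(2)[of v] by (simp add: algebra_simps)
    finally have "\<bar>x\<bar> * \<bar>g (w + v) - g w\<bar> \<le> \<bar>x\<bar> * ((K + \<eta>') * norm v)"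
      by (intro mult_left_mono) auto
    also have "\<dots> \<le> \<eta> / (2 * (K + \<eta>')) * ((K + \<eta>') * norm v)"
      using x K \<eta>' by (intro mult_right_mono) (auto simp: \<rho>_def)
    also have "\<dots> = \<eta> / 2 * norm v" using K \<eta>' by (simp add: divide_simps)
    finally have 1: "\<bar>x * (g (w + v) - g w)\<bar> \<le> \<eta> / 2 * norm v" by (simp add: abs_mult)
    have "\<bar>c\<bar> * \<bar>g (w + v) - g w - g' v\<bar> \<le> \<bar>c\<bar> * (\<eta>' * norm v)"
      by (intro mult_left_mono r) auto
    also have "\<dots> \<le> \<eta> / 2 * norm v"
      using mult_right_mono[OF \<eta>'(2) norm_ge_zero[of v]] by (simp add: mult.assoc)
    finally have 2: "\<bar>c * (g (w + v) - g w - g' v)\<bar> \<le> \<eta> / 2 * norm v" by (simp add: abs_mult)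
    have "(c + x) * g (w + v) - c * g w - (x * g w + c * g' v)
      = c * (g (w + v) - g w - g' v) + x * (g (w + v) - g w)" by (simp add: algebra_simps)
    then show "\<bar>(c + x) * g (w + v) - c * g w - (x * g w + c * g' v)\<bar> \<le> \<eta> * norm v"
      using 1 2 by linarith
  qed
qed

section \<open>Linearisation of the pointing error\<close>

text \<open>The columns \<open>(c\<^sub>1, c\<^sub>5)\<close>, \<open>(c\<^sub>2, c\<^sub>4)\<close> and \<open>(0, c\<^sub>3)\<close> of the Jacobian of the footprint centre.\<close>

definition sens_x :: "real \<Rightarrow> real \<Rightarrow> real \<Rightarrow> real \<times> real" where
  "sens_x mx my mz = (let th = track_theta mx my; ph = track_phi mx my mz in
     (- tan th, - (cot ph / cos th)))"

definition sens_theta :: "real \<Rightarrow> real \<Rightarrow> real \<Rightarrow> real \<times> real" where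
  "sens_theta mx my mz = (let th = track_theta mx my; ph = track_phi mx my mz in
     (- (mx / (cos th)\<^sup>2), - (mx * cot ph * tan th / cos th)))"

definition sens_phi :: "real \<Rightarrow> real \<Rightarrow> real \<Rightarrow> real \<times> real" where
  "sens_phi mx my mz = (let th = track_theta mx my; ph = track_phi mx my mz in
     (0, mx / ((sin ph)\<^sup>2 * cos th)))"

definition linear_error :: "real \<Rightarrow> real \<Rightarrow> real \<Rightarrow> (source \<Rightarrow> real) \<Rightarrow> real \<times> real" where
  "linear_error mx my mz e = (e SY, e SZ) + e SPhi *\<^sub>R sens_phi mx my mz
     + e SX *\<^sub>R sens_x mx my mz + e STheta *\<^sub>R sens_theta mx my mz"

text \<open>Regularity of the footprint map at the mean angles, together with the fact that the mean
  beam hits the origin of the plane, which removes the constant term of the linearisation.\<close>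

lemma track_facts:
  fixes mx my mz :: real
  assumes "mx \<noteq> 0"
  defines "th \<equiv> track_theta mx my" and "ph \<equiv> track_phi mx my mz"
  shows "cos th \<noteq> 0" "sin ph \<noteq> 0" "mx * tan th = my" "mx * (cot ph / cos th) = mz"
proof -
  define R where "R = sqrt (mx\<^sup>2 + my\<^sup>2 + mz\<^sup>2)"
  have R: "R > 0" using assms(1) unfolding R_def by (simp add: add_pos_nonneg)
  note pt = perfect_tracking[OF assms(1), of my mz, folded th_def ph_def R_def]
  have prod: "sin ph * cos th \<noteq> 0" using pt(1) R assms(1) by simp
  then show c: "cos th \<noteq> 0" and s: "sin ph \<noteq> 0" by auto
  have "sin ph * (mx * sin th) = sin ph * (my * cos th)"
    using arg_cong[OF pt(2), of "(*) mx"] arg_cong[OF pt(1), of "(*) my"] by (simp add: mult_ac)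
  then have "mx * sin th = my * cos th" using s by simp
  then show "mx * tan th = my" using c by (simp add: tan_def)
  have "mx * cos ph = mz * (sin ph * cos th)"
    using arg_cong[OF pt(3), of "(*) mx"] arg_cong[OF pt(1), of "(*) mz"] by (simp add: mult_ac)
  then show "mx * (cot ph / cos th) = mz" using c s by (simp add: cot_def divide_simps mult_ac)
qed

text \<open>The errors of \<open>r\<^sub>y\<close> and \<open>r\<^sub>z\<close> enter linearly and
  cancel exactly. Only the products of \<open>r\<^sub>x\<close> with \<open>tan \<theta>\<close> and
  with \<open>cot \<phi> / cos \<theta>\<close> leave a remainder, each with half of
  \<open>\<eta>\<close>; the reverse triangle inequality passes to norms.\<close>

lemma pointing_error_linearization:
  assumes mx: "mx \<noteq> 0" and "\<eta> > 0"
  obtains \<rho> where "\<rho> > 0"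
    "\<And>e. \<bar>e SX\<bar> < \<rho> \<Longrightarrow> \<bar>e STheta\<bar> + \<bar>e SPhi\<bar> < \<rho> \<Longrightarrow>
      \<bar>pointing_error mx my mz e - norm (linear_error mx my mz e)\<bar> \<le> \<eta> * (\<bar>e STheta\<bar> + \<bar>e SPhi\<bar>)"
proof -
  define th ph where "th = track_theta mx my" and "ph = track_phi mx my mz"
  note tf = track_facts(1)[OF mx, of my, folded th_def] track_facts(2)[OF mx, of my mz, folded ph_def]
    track_facts(3)[OF mx, of my, folded th_def] track_facts(4)[OF mx, of my mz, folded th_def ph_def]
  define g1 g2 where "g1 = (\<lambda>w::real \<times> real. tan (fst w))" and "g2 = (\<lambda>w::real \<times> real. cot (snd w) / cos (fst w))"
  define g1' g2' where "g1' = (\<lambda>v::real \<times> real. fst v * inverse ((cos th)\<^sup>2))"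
    and "g2' = (\<lambda>v::real \<times> real. snd v * (- inverse ((sin ph)\<^sup>2)) / cos th + cot ph * (fst v * sin th / (cos th)\<^sup>2))"
  have d1: "(g1 has_derivative g1') (at (th, ph))"
    unfolding g1_def g1'_def
    by (rule DERIV_compose_FDERIV[where f = tan and g = fst])
       (use tf in \<open>auto intro!: DERIV_tan derivative_eq_intros\<close>)
  have "((\<lambda>w. cot (snd w)) has_derivative (\<lambda>v. snd v * (- inverse ((sin ph)\<^sup>2)))) (at (th, ph))"
    by (rule DERIV_compose_FDERIV[where f = cot and g = snd])
       (use tf in \<open>auto intro!: DERIV_cot derivative_eq_intros\<close>)
  moreover have "((\<lambda>w. inverse (cos (fst w))) has_derivative (\<lambda>v. fst v * (sin th / (cos th)\<^sup>2))) (at (th, ph))"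
  proof (rule DERIV_compose_FDERIV[where f = "\<lambda>x. inverse (cos x)" and g = fst])
    show "((\<lambda>x. inverse (cos x)) has_real_derivative sin th / (cos th)\<^sup>2) (at (fst (th, ph)))"
      using tf by (auto intro!: derivative_eq_intros simp: power2_eq_square field_simps)
  qed (auto intro!: derivative_eq_intros)
  ultimately have d2: "(g2 has_derivative g2') (at (th, ph))"
    unfolding g2_def g2'_def divide_inverse
    by (rule has_derivative_eq_rhs[OF has_derivative_mult]) (auto simp: fun_eq_iff field_simps power2_eq_square)
  have \<eta>2: "\<eta> / 2 > 0" using \<open>\<eta> > 0\<close> by simp
  obtain \<rho>1 where \<rho>1: "\<rho>1 > 0" "\<And>v x. norm v < \<rho>1 \<Longrightarrow> \<bar>x\<bar> < \<rho>1 \<Longrightarrow>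
      \<bar>(mx + x) * g1 ((th, ph) + v) - mx * g1 (th, ph) - (x * g1 (th, ph) + mx * g1' v)\<bar> \<le> \<eta> / 2 * norm v"
    using product_linearization[OF d1 \<eta>2] by metis
  obtain \<rho>2 where \<rho>2: "\<rho>2 > 0" "\<And>v x. norm v < \<rho>2 \<Longrightarrow> \<bar>x\<bar> < \<rho>2 \<Longrightarrow>
      \<bar>(mx + x) * g2 ((th, ph) + v) - mx * g2 (th, ph) - (x * g2 (th, ph) + mx * g2' v)\<bar> \<le> \<eta> / 2 * norm v"
    using product_linearization[OF d2 \<eta>2] by metis
  show thesis
  proof (rule that[of "min \<rho>1 \<rho>2"])
    show "min \<rho>1 \<rho>2 > 0" using \<rho>1 \<rho>2 by simp
    fix e :: "source \<Rightarrow> real"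
    assume ex: "\<bar>e SX\<bar> < min \<rho>1 \<rho>2" and ev: "\<bar>e STheta\<bar> + \<bar>e SPhi\<bar> < min \<rho>1 \<rho>2"
    define v where "v = (e STheta, e SPhi)"
    have nv: "norm v \<le> \<bar>e STheta\<bar> + \<bar>e SPhi\<bar>"
      unfolding v_def using norm_Pair_le[of "e STheta" "e SPhi"] by simp
    define F where "F = (footprint_y (mx + e SX) (my + e SY) (th + e STheta),
      footprint_z (mx + e SX) (mz + e SZ) (th + e STheta) (ph + e SPhi))"
    have pe: "pointing_error mx my mz e = norm F"
      by (simp add: pointing_error_def F_def norm_Pair Let_def th_def ph_def)
    have 1: "fst (F - linear_error mx my mz e) =
      - ((mx + e SX) * g1 ((th, ph) + v) - mx * g1 (th, ph) - (e SX * g1 (th, ph) + mx * g1' v))"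
      using tf(3) by (simp add: F_def footprint_y_def linear_error_def sens_x_def sens_theta_def sens_phi_def Let_def
          th_def[symmetric] ph_def[symmetric] g1_def g1'_def v_def divide_inverse)
    have 2: "snd (F - linear_error mx my mz e) =
      - ((mx + e SX) * g2 ((th, ph) + v) - mx * g2 (th, ph) - (e SX * g2 (th, ph) + mx * g2' v))"
    proof -
      have a: "snd F = mz + e SZ - (mx + e SX) * g2 ((th, ph) + v)"
        by (simp add: F_def footprint_z_def g2_def v_def)
      have b: "snd (linear_error mx my mz e) = e SZ - (e SX * g2 (th, ph) + mx * g2' v)"
        using tf(1,2) by (simp add: linear_error_def sens_x_def sens_theta_def sens_phi_def Let_def
          th_def[symmetric] ph_def[symmetric] g2_def g2'_def v_def tan_def field_simps power2_eq_square)
      have c: "mx * g2 (th, ph) = mz" using tf(4) by (simp add: g2_def)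
      show ?thesis unfolding snd_diff a b c by simp
    qed
    have "\<bar>norm F - norm (linear_error mx my mz e)\<bar> \<le> norm (F - linear_error mx my mz e)"
      by (rule norm_triangle_ineq3)
    also have "\<dots> \<le> \<bar>fst (F - linear_error mx my mz e)\<bar> + \<bar>snd (F - linear_error mx my mz e)\<bar>"
      by (metis norm_Pair_le prod.collapse real_norm_def)
    also have "\<dots> \<le> \<eta> / 2 * norm v + \<eta> / 2 * norm v"
      unfolding 1 2 abs_minus_cancel using nv ex ev by (intro add_mono \<rho>1(2) \<rho>2(2)) auto
    also have "\<dots> = \<eta> * norm v" by simp
    also have "\<dots> \<le> \<eta> * (\<bar>e STheta\<bar> + \<bar>e SPhi\<bar>)"
      using nv \<open>\<eta> > 0\<close> by (intro mult_left_mono) auto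
    finally show "\<bar>pointing_error mx my mz e - norm (linear_error mx my mz e)\<bar> \<le> \<eta> * (\<bar>e STheta\<bar> + \<bar>e SPhi\<bar>)"
      unfolding pe .
  qed
qed

section \<open>The quantitative bound for fixed standard deviations\<close>

lemma borel_measurable_pointing_error:
  assumes [measurable]: "\<And>s. e s \<in> borel_measurable M"
  shows "(\<lambda>\<omega>. pointing_error mx my mz (\<lambda>s. e s \<omega>)) \<in> borel_measurable M"
  unfolding pointing_error_def footprint_y_def footprint_z_def tan_def cot_def Let_def by measurable

text \<open>The summands are the probability of leaving the region of linearisation, the probability
  that an angle exceeds \<open>A\<close> standard deviations, and the cost of shifting the threshold
  by \<open>\<delta> * sqrt (l1 + l2)\<close>.\<close>

lemma (in prob_space) pointing_error_cdf_bound: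
  fixes e :: "source \<Rightarrow> 'a \<Rightarrow> real" and \<sigma> :: "real ^ source"
  assumes ind: "indep_vars (\<lambda>_. borel) e UNIV"
    and dist: "\<And>s. distributed M lborel (e s) (\<lambda>x. ennreal (normal_density 0 (\<sigma> $ s) x))"
    and pos: "\<And>s. \<sigma> $ s > 0"
    and eig: "{k. eigenvalue (Sigma_matrix mx my mz \<sigma>) k} = {l1, l2}"
    and \<kappa>: "\<kappa> > 0" "\<kappa> \<le> \<bar>fst (sens_theta mx my mz)\<bar>" "\<kappa> \<le> \<bar>snd (sens_phi mx my mz)\<bar>"
    and par: "A > 0" "\<delta> > 0" "\<rho> > 0"
    and lin: "\<And>e. \<bar>e SX\<bar> < \<rho> \<Longrightarrow> \<bar>e STheta\<bar> + \<bar>e SPhi\<bar> < \<rho> \<Longrightarrow>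
      \<bar>pointing_error mx my mz e - norm (linear_error mx my mz e)\<bar> \<le> \<delta> * \<kappa> / (2 * A) * (\<bar>e STheta\<bar> + \<bar>e SPhi\<bar>)"
  shows "\<bar>prob {\<omega>\<in>space M. pointing_error mx my mz (\<lambda>s. e s \<omega>) \<le> t}
      - cdf (hoyt (sqrt (min l1 l2 / max l1 l2)) (l1 + l2)) t\<bar> \<le> 9 * (norm \<sigma>)\<^sup>2 / \<rho>\<^sup>2 + 2 / A\<^sup>2 + 2 * \<delta>"
proof -
  define u v w where "u = sens_phi mx my mz" and "v = sens_x mx my mz" and "w = sens_theta mx my mz"
  define a where "a = (\<sigma> $ SY)\<^sup>2 + (fst u)\<^sup>2 * (\<sigma> $ SPhi)\<^sup>2 + (fst v)\<^sup>2 * (\<sigma> $ SX)\<^sup>2 + (fst w)\<^sup>2 * (\<sigma> $ STheta)\<^sup>2"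
  define b where "b = fst u * snd u * (\<sigma> $ SPhi)\<^sup>2 + fst v * snd v * (\<sigma> $ SX)\<^sup>2 + fst w * snd w * (\<sigma> $ STheta)\<^sup>2"
  define d where "d = (\<sigma> $ SZ)\<^sup>2 + (snd u)\<^sup>2 * (\<sigma> $ SPhi)\<^sup>2 + (snd v)\<^sup>2 * (\<sigma> $ SX)\<^sup>2 + (snd w)\<^sup>2 * (\<sigma> $ STheta)\<^sup>2"
  note comb = distributed_gaussian_combination[OF ind dist pos, of u v w, folded a_def b_def d_def]
  have em[measurable]: "e s \<in> borel_measurable M" for s using distributed_measurable[OF dist[of s]] by simp
  define V where "V \<omega> = linear_error mx my mz (\<lambda>s. e s \<omega>)" for \<omega>
  have Vd: "distributed M lborel V (\<lambda>x. ennreal (gauss2 a b d x))"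
    using comb(1) by (simp add: V_def[abs_def] linear_error_def u_def v_def w_def)
  have Vm[measurable]: "V \<in> borel_measurable M" using distributed_measurable[OF Vd] by simp
  have "Sigma_matrix mx my mz \<sigma> = mat_of_rows_list 2 [[a, b], [b, d]]"
    by (simp add: Sigma_matrix_def Let_def a_def b_def d_def u_def v_def w_def sens_x_def sens_theta_def sens_phi_def
        algebra_simps)
  then have "{k. k\<^sup>2 - (a + d) * k + (a * d - b\<^sup>2) = 0} = {l1, l2}"
    using eig by (simp add: eigenvalue_mat_2)
  note sum_prod = quadratic_root_set[OF this]
  define l L where "l = min l1 l2" and "L = max l1 l2"
  have lL: "l + L = a + d" "l * L = a * d - b\<^sup>2" "l \<le> L" "l1 + l2 = l + L"
    using sum_prod by (auto simp: l_def L_def min_def max_def mult.commute add.commute)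
  have "a * d > 0" using comb(3) zero_le_power2[of b] by linarith
  then have "d > 0" using comb(2) by (simp add: zero_less_mult_iff)
  then have sum_pos: "l + L > 0" using comb(2) lL(1) by simp
  have l: "l > 0"
  proof -
    have "L > 0" using sum_pos lL(3) by linarith
    moreover have "l * L > 0" using lL(2) comb(3) by simp
    ultimately show ?thesis by (simp add: zero_less_mult_iff)
  qed
  define h where "h = \<delta> * sqrt (l + L)"
  have h: "h > 0" using sum_pos par by (simp add: h_def)
  \<comment> \<open>The trace contains the squared first entry of \<open>sens_theta\<close> times
    the variance of the azimuth and the squared second entry of \<open>sens_phi\<close> times that
    of the polar angle.\<close>
  have scale: "\<kappa> * \<sigma> $ STheta \<le> sqrt (l + L)" "\<kappa> * \<sigma> $ SPhi \<le> sqrt (l + L)"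
  proof -
    have "(\<kappa> * \<sigma> $ STheta)\<^sup>2 \<le> (fst w)\<^sup>2 * (\<sigma> $ STheta)\<^sup>2"
      using power_mono[OF \<kappa>(2), of 2] \<kappa>(1) by (simp add: power_mult_distrib w_def mult_right_mono)
    also have "\<dots> \<le> a" by (simp add: a_def)
    also have "\<dots> \<le> l + L" using lL(1) \<open>d > 0\<close> by simp
    finally show "\<kappa> * \<sigma> $ STheta \<le> sqrt (l + L)" by (rule real_le_rsqrt)
    have "(\<kappa> * \<sigma> $ SPhi)\<^sup>2 \<le> (snd u)\<^sup>2 * (\<sigma> $ SPhi)\<^sup>2"
      using power_mono[OF \<kappa>(3), of 2] \<kappa>(1) by (simp add: power_mult_distrib u_def mult_right_mono)
    also have "\<dots> \<le> d" by (simp add: d_def)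
    also have "\<dots> \<le> l + L" using lL(1) comb(2) by simp
    finally show "\<kappa> * \<sigma> $ SPhi \<le> sqrt (l + L)" by (rule real_le_rsqrt)
  qed
  define U where "U \<omega> = pointing_error mx my mz (\<lambda>s. e s \<omega>)" for \<omega>
  have Um[measurable]: "U \<in> borel_measurable M" unfolding U_def by (rule borel_measurable_pointing_error) simp
  define T where "T s c = {\<omega>\<in>space M. c \<le> \<bar>e s \<omega>\<bar>}" for s c
  have Tm[measurable]: "T s c \<in> events" for s c unfolding T_def by measurable
  have Tp: "prob (T s c) \<le> (\<sigma> $ s)\<^sup>2 / c\<^sup>2" if "c > 0" for s c
    unfolding T_def by (rule normal_tail_le[OF dist pos that])
  \<comment> \<open>If both angles stay below \<open>A\<close> standard deviations,
    \<open>scale\<close> bounds their weighted sum by \<open>2 * A * sqrt (l + L)\<close>. The slope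
    \<open>\<delta> * \<kappa> / (2 * A)\<close> in \<open>lin\<close> is made to turn this into
    exactly \<open>h\<close>.\<close>
  have sub: "{\<omega>\<in>space M. h < \<bar>U \<omega> - norm (V \<omega>)\<bar>} \<subseteq> T SX \<rho> \<union> (T STheta (\<rho> / 2) \<union> (T SPhi (\<rho> / 2)
      \<union> (T STheta (A * \<sigma> $ STheta) \<union> T SPhi (A * \<sigma> $ SPhi))))"
  proof safe
    fix \<omega> assume \<omega>: "\<omega> \<in> space M" and far: "h < \<bar>U \<omega> - norm (V \<omega>)\<bar>"
      and n: "\<omega> \<notin> T SX \<rho>" "\<omega> \<notin> T STheta (\<rho> / 2)" "\<omega> \<notin> T SPhi (\<rho> / 2)" "\<omega> \<notin> T SPhi (A * \<sigma> $ SPhi)"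
    have "\<bar>e SX \<omega>\<bar> < \<rho>" "\<bar>e STheta \<omega>\<bar> + \<bar>e SPhi \<omega>\<bar> < \<rho>" using n \<omega> by (auto simp: T_def)
    then have "\<bar>U \<omega> - norm (V \<omega>)\<bar> \<le> \<delta> * \<kappa> / (2 * A) * (\<bar>e STheta \<omega>\<bar> + \<bar>e SPhi \<omega>\<bar>)"
      unfolding U_def V_def by (rule lin[of "\<lambda>s. e s \<omega>"])
    with far have "\<delta> * sqrt (l + L) < \<delta> * (\<kappa> / (2 * A) * (\<bar>e STheta \<omega>\<bar> + \<bar>e SPhi \<omega>\<bar>))"
      by (simp add: h_def)
    then have "sqrt (l + L) < \<kappa> / (2 * A) * (\<bar>e STheta \<omega>\<bar> + \<bar>e SPhi \<omega>\<bar>)"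
      using par by (simp only: mult_less_cancel_left_pos)
    then have big: "2 * A * sqrt (l + L) < \<kappa> * (\<bar>e STheta \<omega>\<bar> + \<bar>e SPhi \<omega>\<bar>)"
      using par by (simp add: field_simps)
    have "\<bar>e SPhi \<omega>\<bar> < A * \<sigma> $ SPhi" using n(4) \<omega> by (simp add: T_def)
    then have "\<kappa> * \<bar>e SPhi \<omega>\<bar> \<le> \<kappa> * (A * \<sigma> $ SPhi)" using \<kappa> by (intro mult_left_mono) auto
    also have "\<dots> = A * (\<kappa> * \<sigma> $ SPhi)" by simp
    also have "\<dots> \<le> A * sqrt (l + L)" using par by (intro mult_left_mono scale) auto
    finally have "A * sqrt (l + L) < \<kappa> * \<bar>e STheta \<omega>\<bar>"
      using big by (simp add: distrib_left)
    moreover have "A * (\<kappa> * \<sigma> $ STheta) \<le> A * sqrt (l + L)" using par by (intro mult_left_mono scale) auto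
    ultimately have "\<kappa> * (A * \<sigma> $ STheta) \<le> \<kappa> * \<bar>e STheta \<omega>\<bar>" by (simp add: mult.left_commute)
    then have "A * \<sigma> $ STheta \<le> \<bar>e STheta \<omega>\<bar>" using \<kappa>(1) by (simp only: mult_le_cancel_left_pos)
    then show "\<omega> \<in> T STheta (A * \<sigma> $ STheta)" using \<omega> by (simp add: T_def)
  qed
  have s2: "(\<sigma> $ s)\<^sup>2 \<le> (norm \<sigma>)\<^sup>2" for s
    using component_le_norm_cart[of \<sigma> s] pos[of s] by (intro power_mono) auto
  have "prob {\<omega>\<in>space M. h < \<bar>U \<omega> - norm (V \<omega>)\<bar>} \<le> prob (T SX \<rho> \<union> (T STheta (\<rho> / 2) \<union> (T SPhi (\<rho> / 2)
      \<union> (T STheta (A * \<sigma> $ STheta) \<union> T SPhi (A * \<sigma> $ SPhi)))))"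
    by (rule finite_measure_mono[OF sub]) measurable
  also have "\<dots> \<le> prob (T SX \<rho>) + (prob (T STheta (\<rho> / 2)) + (prob (T SPhi (\<rho> / 2))
      + (prob (T STheta (A * \<sigma> $ STheta)) + prob (T SPhi (A * \<sigma> $ SPhi)))))"
    by (intro order_trans[OF measure_Un_le] add_left_mono order_refl) measurable
  \<comment> \<open>The threshold \<open>\<rho>\<close> for \<open>SX\<close> costs one unit and the
    thresholds \<open>\<rho> / 2\<close> for the two angles cost four each, which makes 9.\<close>
  also have "\<dots> \<le> (norm \<sigma>)\<^sup>2 / \<rho>\<^sup>2 + (4 * (norm \<sigma>)\<^sup>2 / \<rho>\<^sup>2 + (4 * (norm \<sigma>)\<^sup>2 / \<rho>\<^sup>2 + (1 / A\<^sup>2 + 1 / A\<^sup>2)))"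
  proof -
    have 1: "prob (T s c) \<le> (norm \<sigma>)\<^sup>2 / c\<^sup>2" if "c > 0" for s c
      using Tp[OF that, of s] s2[of s] by (meson divide_right_mono order_trans zero_le_power2)
    have 2: "prob (T s (A * \<sigma> $ s)) \<le> 1 / A\<^sup>2" for s
      using Tp[of "A * \<sigma> $ s" s] par pos[of s] by (simp add: power_mult_distrib)
    have 3: "prob (T s (\<rho> / 2)) \<le> 4 * (norm \<sigma>)\<^sup>2 / \<rho>\<^sup>2" for s
      using 1[of "\<rho> / 2" s] par by (simp add: power_divide mult.commute)
    show ?thesis using 1[OF par(3)] by (intro add_mono 2 3) auto
  qed
  also have "\<dots> = 9 * (norm \<sigma>)\<^sup>2 / \<rho>\<^sup>2 + 2 / A\<^sup>2" by simp
  finally have close: "prob {\<omega>\<in>space M. h < \<bar>U \<omega> - norm (V \<omega>)\<bar>} \<le> 9 * (norm \<sigma>)\<^sup>2 / \<rho>\<^sup>2 + 2 / A\<^sup>2" .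
  have "\<bar>prob {\<omega>\<in>space M. U \<omega> \<le> t} - cdf (hoyt (sqrt (l / L)) (l + L)) t\<bar>
      \<le> (9 * (norm \<sigma>)\<^sup>2 / \<rho>\<^sup>2 + 2 / A\<^sup>2) + 2 / sqrt (l + L) * h"
  proof (rule cdf_sandwich[where V = "\<lambda>\<omega>. norm (V \<omega>)"])
    show "emeasure M {\<omega>\<in>space M. norm (V \<omega>) \<le> t} = emeasure (hoyt (sqrt (l / L)) (l + L)) {..t}" for t
      by (rule emeasure_norm_gauss2[OF Vd lL(1,2) l lL(3)])
    show "emeasure (hoyt (sqrt (l / L)) (l + L)) {s<..t} \<le> ennreal (2 / sqrt (l + L) * (t - s))" if "s \<le> t" for s t
      by (rule emeasure_hoyt_interval_le[OF l lL(3) that])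
  qed (use close h sum_pos in \<open>auto simp: hoyt_def\<close>)
  also have "2 / sqrt (l + L) * h = 2 * \<delta>" using sum_pos by (simp add: h_def)
  finally show ?thesis unfolding U_def l_def[symmetric] L_def[symmetric] lL(4) by simp
qed

theorem theorem2:
  fixes mx my mz :: real
    and M :: "real ^ source \<Rightarrow> 'a measure"
    and \<epsilon> :: "real ^ source \<Rightarrow> source \<Rightarrow> 'a \<Rightarrow> real"
    and lam1 lam2 q \<Omega> :: "real ^ source \<Rightarrow> real"
  assumes "mx \<noteq> 0"
    and "\<And>\<sigma>. (\<forall>s. 0 < \<sigma> $ s) \<Longrightarrow> prob_space (M \<sigma>)"
    and "\<And>\<sigma>. (\<forall>s. 0 < \<sigma> $ s) \<Longrightarrow> prob_space.indep_vars (M \<sigma>) (\<lambda>_. borel) (\<epsilon> \<sigma>) UNIV"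
    and "\<And>\<sigma> s. (\<forall>s. 0 < \<sigma> $ s) \<Longrightarrow>
           distributed (M \<sigma>) lborel (\<epsilon> \<sigma> s) (\<lambda>x. ennreal (normal_density 0 (\<sigma> $ s) x))"
    and "\<And>\<sigma>. (\<forall>s. 0 < \<sigma> $ s) \<Longrightarrow>
           {k. eigenvalue (Sigma_matrix mx my mz \<sigma>) k} = {lam1 \<sigma>, lam2 \<sigma>}"
    and "\<And>\<sigma>. (\<forall>s. 0 < \<sigma> $ s) \<Longrightarrow>
           q \<sigma> = sqrt (min (lam1 \<sigma>) (lam2 \<sigma>) / max (lam1 \<sigma>) (lam2 \<sigma>))"
    and "\<And>\<sigma>. (\<forall>s. 0 < \<sigma> $ s) \<Longrightarrow> \<Omega> \<sigma> = lam1 \<sigma> + lam2 \<sigma>"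
  shows "((\<lambda>\<sigma>. SUP t::real.
            \<bar>measure (M \<sigma>) {\<omega> \<in> space (M \<sigma>). pointing_error mx my mz (\<lambda>s. \<epsilon> \<sigma> s \<omega>) \<le> t}
              - cdf (hoyt (q \<sigma>) (\<Omega> \<sigma>)) t\<bar>) \<longlongrightarrow> 0)
         (at 0 within {\<sigma>. \<forall>s. 0 < \<sigma> $ s})"
proof (rule tendstoI)
  let ?f = "\<lambda>\<sigma> t. \<bar>measure (M \<sigma>) {\<omega> \<in> space (M \<sigma>). pointing_error mx my mz (\<lambda>s. \<epsilon> \<sigma> s \<omega>) \<le> t}
              - cdf (hoyt (q \<sigma>) (\<Omega> \<sigma>)) t\<bar>"
  fix r :: real assume r: "r > 0"
  \<comment> \<open>These are \<open>\<bar>c\<^sub>2\<bar>\<close> and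
    \<open>\<bar>c\<^sub>3\<bar>\<close>, nonzero because \<open>mx \<noteq> 0\<close>.\<close>
  define \<kappa> where "\<kappa> = min \<bar>fst (sens_theta mx my mz)\<bar> \<bar>snd (sens_phi mx my mz)\<bar>"
  have \<kappa>: "\<kappa> > 0" "\<kappa> \<le> \<bar>fst (sens_theta mx my mz)\<bar>" "\<kappa> \<le> \<bar>snd (sens_phi mx my mz)\<bar>"
    using assms(1) track_facts(1)[OF assms(1), of my] track_facts(2)[OF assms(1), of my mz]
    by (auto simp: \<kappa>_def sens_theta_def sens_phi_def Let_def)
  \<comment> \<open>Both \<open>2 / A\<^sup>2\<close> and \<open>2 * \<delta>\<close> equal
    \<open>r / 4\<close>. They are fixed before \<open>\<rho>\<close>, whose choice depends on the
    slope \<open>\<delta> * \<kappa> / (2 * A)\<close>.\<close>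
  define A \<delta> where "A = sqrt (8 / r)" and "\<delta> = r / 8"
  have par: "A > 0" "\<delta> > 0" "2 / A\<^sup>2 = r / 4" using r by (auto simp: A_def \<delta>_def)
  obtain \<rho> where \<rho>: "\<rho> > 0" and lin: "\<And>e. \<bar>e SX\<bar> < \<rho> \<Longrightarrow> \<bar>e STheta\<bar> + \<bar>e SPhi\<bar> < \<rho> \<Longrightarrow>
      \<bar>pointing_error mx my mz e - norm (linear_error mx my mz e)\<bar> \<le> \<delta> * \<kappa> / (2 * A) * (\<bar>e STheta\<bar> + \<bar>e SPhi\<bar>)"
    using pointing_error_linearization[OF assms(1), of "\<delta> * \<kappa> / (2 * A)" my mz] par \<kappa>(1)
    by (metis divide_pos_pos mult_pos_pos zero_less_numeral)
  \<comment> \<open>This radius makes the third summand at most \<open>r / 4\<close>. The total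
    \<open>3 / 4 * r\<close> leaves room for a strict inequality after the supremum.\<close>
  have "\<forall>\<sigma>\<in>{\<sigma>. \<forall>s. 0 < \<sigma> $ s}. \<sigma> \<noteq> 0 \<and> dist \<sigma> 0 < \<rho> * sqrt r / 6 \<longrightarrow> dist (SUP t. ?f \<sigma> t) 0 < r"
  proof (intro ballI impI)
    fix \<sigma> :: "real ^ source"
    assume "\<sigma> \<in> {\<sigma>. \<forall>s. 0 < \<sigma> $ s}" and "\<sigma> \<noteq> 0 \<and> dist \<sigma> 0 < \<rho> * sqrt r / 6"
    then have pos: "\<forall>s. 0 < \<sigma> $ s" and small: "norm \<sigma> < \<rho> * sqrt r / 6" by auto
    interpret prob_space "M \<sigma>" by (rule assms(2)[OF pos])
    have "(norm \<sigma>)\<^sup>2 \<le> (\<rho> * sqrt r / 6)\<^sup>2" using small by (intro power_mono) auto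
    also have "\<dots> = \<rho>\<^sup>2 * r / 36" using r by (simp add: power_mult_distrib power_divide)
    finally have "9 * (norm \<sigma>)\<^sup>2 / \<rho>\<^sup>2 \<le> r / 4" using \<rho> by (simp add: field_simps)
    then have le: "?f \<sigma> t \<le> 3 / 4 * r" for t
      using pointing_error_cdf_bound[OF assms(3)[OF pos] assms(4)[OF pos] _ assms(5)[OF pos] \<kappa> par(1,2) \<rho> lin, of t] pos par(3)
      by (simp add: assms(6,7)[OF pos] \<delta>_def)
    have "(SUP t. ?f \<sigma> t) \<le> 3 / 4 * r" by (rule cSUP_least) (use le in auto)
    moreover have "0 \<le> (SUP t. ?f \<sigma> t)"
      by (rule cSUP_upper2[where x = 0, OF bdd_aboveI2[OF le]]) auto
    ultimately show "dist (SUP t. ?f \<sigma> t) 0 < r" using r by simp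
  qed
  then show "\<forall>\<^sub>F \<sigma> in at 0 within {\<sigma>. \<forall>s. 0 < \<sigma> $ s}. dist (SUP t. ?f \<sigma> t) 0 < r"
    unfolding eventually_at using \<rho> r by (intro exI[of _ "\<rho> * sqrt r / 6"]) auto
qed

end
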